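(* Let $N\geq 2$ and $1\leq m<N-2$ be integers, let $0<a<b<\infty$, and let \[ \Omega:=\{x=(y,z)\in\mathbb{R}^{m+1}\times\mathbb{R}^{N-m-1}: a<|y|<b\}. \] Let $p\geq \frac{2(N-m)}{N-m-2}$. Then the problem \[ -\Delta u=|u|^{p-2}u \text{ in }\Omega,\qquad u=0 \text{ on }\partial\Omega,\qquad |\nabla u|^2,\ |u|^p\in L^1(\Omega), \] has no nontrivial solution $u\in\mathcal{C}^2(\Omega)\cap\mathcal{C}^1(\overline{\Omega})$. *)

theory Defs
  imports "HOL-Analysis.Analysis"
begin

definition pderiv_dir :: "('a::euclidean_space \<Rightarrow> real) \<Rightarrow> 'a \<Rightarrow> 'a \<Rightarrow> real" where
  "pderiv_dir u v x = frechet_derivative u (at x) v"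

definition C1_on :: "'a::euclidean_space set \<Rightarrow> ('a \<Rightarrow> real) \<Rightarrow> bool" where
  "C1_on S u \<longleftrightarrow> u differentiable_on S \<and>
     (\<forall>i\<in>Basis. continuous_on S (pderiv_dir u i))"

definition C2_on :: "'a::euclidean_space set \<Rightarrow> ('a \<Rightarrow> real) \<Rightarrow> bool" where
  "C2_on S u \<longleftrightarrow> C1_on S u \<and> (\<forall>i\<in>Basis. C1_on S (pderiv_dir u i))"

definition C1_closure :: "'a::euclidean_space set \<Rightarrow> ('a \<Rightarrow> real) \<Rightarrow> bool" where
  "C1_closure S u \<longleftrightarrow> C1_on S u \<and> continuous_on (closure S) u \<and>
     (\<forall>i\<in>Basis. \<exists>g. continuous_on (closure S) g \<and> (\<forall>x\<in>S. g x = pderiv_dir u i x))"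

definition grad :: "('a::euclidean_space \<Rightarrow> real) \<Rightarrow> 'a \<Rightarrow> 'a" where
  "grad u x = (\<Sum>i\<in>Basis. pderiv_dir u i x *\<^sub>R i)"

definition laplacian :: "('a::euclidean_space \<Rightarrow> real) \<Rightarrow> 'a \<Rightarrow> real" where
  "laplacian u x = (\<Sum>i\<in>Basis. pderiv_dir (pderiv_dir u i) i x)"

end

theory Submission
  imports Defs
begin

text \<open>
  Write \<open>k\<close> for the dimension of the \<open>z\<close>-space and let \<open>\<chi> = (\<phi>(y), z)\<close>, where \<open>\<phi>\<close> is radial with \<open>div \<phi> = 1\<close> and
  \<open>\<phi> = 0\<close> on \<open>|y| = a\<close>. The Pohozaev field
  \<open>W = (\<chi> \<bullet> \<nabla>u) \<nabla>u + (|u|\<^sup>p / p - |\<nabla>u|\<^sup>2 / 2) \<chi> + ((k + 1) / p) u \<nabla>u\<close> satisfies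
  \<open>div W = D\<chi>[\<nabla>u] \<bullet> \<nabla>u + ((k + 1) / p - (k + 1) / 2) |\<nabla>u|\<^sup>2\<close>, which for the given range of \<open>p\<close> is at most
  \<open>- c(y) |\<nabla>\<^sub>y u|\<^sup>2\<close> with \<open>c > 0\<close>. On the boundary \<open>\<nabla>u\<close> is normal, so \<open>W\<close> points outwards there, and integrability
  kills the contribution from \<open>|z| \<rightarrow> \<infinity>\<close>. Hence \<open>div W = 0\<close>, so \<open>\<nabla>\<^sub>y u = 0\<close>, and \<open>u\<close> equals its boundary value 0.
\<close>

section \<open>Divergence and Hessian\<close>

text \<open>Let k be \<open>DIM('b)\<close>. The value 1 for \<open>div \<phi>\<close> makes k + 1
  act as the dimension in the exponent condition. It is the largest constant compatible with \<phi>
  = 0 on |y| = a: there the radial eigenvalue of the derivative of \<phi> equals the divergence, and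
  an eigenvalue above 1 would spoil the sign of div W. The vanishing of \<phi> silences the inner
  sphere, since the flux density of W on the boundary is \<open>|\<nabla>u|\<^sup>2 / 2\<close>
  times the outward component of \<chi>. The critical exponent is covered because strictness comes
  from the y-directions alone, where both eigenvalues are below 1; in the z-directions the bound may
  be an equality. Two obstacles shape the argument. Second derivatives of u exist only in the open
  set and need not extend to the closure, so the field cannot be integrated up to the boundary; only
  the sign of its boundary flux is extracted, by cutoffs. And the term \<open>u \<nabla>u\<close> is
  controlled at infinity only if \<open>u\<^sup>2\<close> is integrable, which is no assumption; the
  bounded range of |y| yields it through a Poincare inequality.\<close>

text \<open>By translation invariance every difference quotient of \<open>f\<close> integrates to zero; dominated convergence
  passes this on to the derivative, without Fubini.\<close>

lemma integral_directional_derivative_eq_0: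
  fixes f g :: "'a::euclidean_space \<Rightarrow> real" and i :: 'a
  assumes der: "\<And>x t. ((\<lambda>t. f (x + t *\<^sub>R i)) has_real_derivative g (x + t *\<^sub>R i)) (at t)"
    and contf: "continuous_on UNIV f" and contg: "continuous_on UNIV g"
    and f0: "\<And>x. norm x > R \<Longrightarrow> f x = 0" and g0: "\<And>x. norm x > R \<Longrightarrow> g x = 0"
  shows "(g has_integral 0) UNIV"
proof -
  have intc: "integrable lborel h" if "continuous_on UNIV h" "\<And>x. norm x > R \<Longrightarrow> h x = 0" for h :: "'a \<Rightarrow> real"
  proof -
    have "integrable lborel (\<lambda>x. indicator (cball 0 R) x *\<^sub>R h x)"
      using that by (intro borel_integrable_compact) (auto intro: continuous_on_subset)
    moreover have "(\<lambda>x. indicator (cball 0 R) x *\<^sub>R h x) = h"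
      using that(2) by (force simp: indicator_def)
    ultimately show ?thesis by simp
  qed
  have intf: "integrable lborel f" and intg: "integrable lborel g"
    using intc contf contg f0 g0 by auto
  define s where "s n x = (f (x + (1 / Suc n) *\<^sub>R i) - f x) * Suc n" for n :: nat and x
  have shift: "integrable lborel (\<lambda>x. f (x + c))" "(\<integral>x. f (x + c) \<partial>lborel) = (\<integral>x. f x \<partial>lborel)" for c
  proof -
    have eq: "(\<integral>x. f x \<partial>lborel) = (\<integral>x. f x \<partial>(distr lborel borel ((+) c)))"
      by (simp add: lborel_distr_plus)
    also have "\<dots> = (\<integral>x. f (c + x) \<partial>lborel)"
      by (subst integral_distr) (use contf in \<open>auto intro: borel_measurable_continuous_onI\<close>)
    finally show "(\<integral>x. f (x + c) \<partial>lborel) = (\<integral>x. f x \<partial>lborel)" by (simp add: add.commute)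
    have "integrable (distr lborel borel ((+) c)) f"
      using intf by (simp add: lborel_distr_plus)
    then have "integrable lborel (\<lambda>x. f (c + x))"
      by (subst (asm) integrable_distr_eq) (use contf in \<open>auto intro: borel_measurable_continuous_onI\<close>)
    then show "integrable lborel (\<lambda>x. f (x + c))" by (simp add: add.commute)
  qed
  have ints: "(\<integral>x. s n x \<partial>lborel) = 0" for n
    unfolding s_def using intf shift by simp
  have "bounded (g ` cball 0 R)"
    using contg by (intro compact_imp_bounded compact_continuous_image) (auto intro: continuous_on_subset)
  then obtain M where M: "\<And>x. norm x \<le> R \<Longrightarrow> \<bar>g x\<bar> \<le> M"
    by (force simp: bounded_iff)
  define K where "K = max M 0"
  have K: "\<bar>g x\<bar> \<le> K" for x
    using M[of x] g0[of x] by (cases "norm x \<le> R") (auto simp: K_def)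
  have "(\<lambda>n. \<integral>x. s n x \<partial>lborel) \<longlonglongrightarrow> (\<integral>x. g x \<partial>lborel)"
  proof (rule integral_dominated_convergence)
    \<comment> \<open>Every step 1 / (n + 1) is at most 1, so all difference quotients are supported
      in the ball enlarged by \<open>norm i\<close>.\<close>
    show "integrable lborel (\<lambda>x. indicator (cball 0 (R + norm i)) x *\<^sub>R K)"
      by (intro borel_integrable_compact) auto
    show "AE x in lborel. norm (s n x) \<le> indicator (cball 0 (R + norm i)) x *\<^sub>R K" for n
    proof (rule AE_I2)
      fix x
      let ?t = "1 / real (Suc n)"
      have t: "?t > 0" "?t \<le> 1" by auto
      show "norm (s n x) \<le> indicator (cball 0 (R + norm i)) x *\<^sub>R K"
      proof (cases "norm x \<le> R + norm i")
        case True
        have "\<exists>z. 0 < z \<and> z < ?t \<and> f (x + ?t *\<^sub>R i) - f (x + 0 *\<^sub>R i) = (?t - 0) * g (x + z *\<^sub>R i)"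
          using der by (intro MVT2[OF t(1)]) auto
        then obtain z where "f (x + ?t *\<^sub>R i) - f x = ?t * g (x + z *\<^sub>R i)" by auto
        then have "s n x = g (x + z *\<^sub>R i)" by (simp add: s_def)
        with True K show ?thesis by (simp add: indicator_def)
      next
        case False
        have "norm (?t *\<^sub>R i) \<le> norm i" using t mult_right_mono[OF t(2) norm_ge_zero[of i]] by simp
        then have "norm (x + ?t *\<^sub>R i) > R" using False norm_diff_ineq[of x "?t *\<^sub>R i"] by linarith
        moreover have "norm x > R" using False norm_ge_zero[of i] by linarith
        ultimately show ?thesis using f0 False by (simp add: s_def indicator_def)
      qed
    qed
    show "AE x in lborel. (\<lambda>n. s n x) \<longlonglongrightarrow> g x"
    proof (rule AE_I2)
      fix x
      have "((\<lambda>t. (f (x + t *\<^sub>R i) - f x) / t) \<longlongrightarrow> g x) (at 0)"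
        using der[of x 0] by (simp add: DERIV_def)
      moreover have "filterlim (\<lambda>n. 1 / real (Suc n)) (at 0) sequentially"
        using LIMSEQ_inverse_real_of_nat unfolding filterlim_at by (simp add: inverse_eq_divide)
      ultimately have "((\<lambda>n. (f (x + (1 / real (Suc n)) *\<^sub>R i) - f x) / (1 / real (Suc n))) \<longlongrightarrow> g x) sequentially"
        by (rule filterlim_compose)
      then show "(\<lambda>n. s n x) \<longlonglongrightarrow> g x" by (simp add: s_def)
    qed
    show "s n \<in> borel_measurable lborel" for n
      unfolding s_def using intf shift by (auto intro!: borel_measurable_integrable)
  qed (use intg in auto)
  then have "(\<integral>x. g x \<partial>lborel) = 0" by (simp add: ints LIMSEQ_const_iff)
  with has_integral_integral_lborel[OF intg] show ?thesis by simp
qed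

text \<open>Each summand differentiates one coordinate of \<open>F\<close> along its own axis, so
  the one-directional statement applies term by term. Far out \<open>F'\<close> vanishes because
  \<open>F\<close> is constant on an open set there.\<close>

lemma integral_divergence_eq_0:
  fixes F :: "'a::euclidean_space \<Rightarrow> 'a"
  assumes der: "\<And>x. (F has_derivative F' x) (at x)"
    and cont: "\<And>i. i \<in> Basis \<Longrightarrow> continuous_on UNIV (\<lambda>x. F' x i \<bullet> i)"
    and F0: "\<And>x. norm x > R \<Longrightarrow> F x = 0"
  shows "((\<lambda>x. \<Sum>i\<in>Basis. F' x i \<bullet> i) has_integral 0) UNIV"
proof -
  have F'0: "F' x = (\<lambda>_. 0)" if "norm x > R" for x
  proof -
    have "open {x::'a. norm x > R}" by (intro open_Collect_less continuous_intros)
    then have "(F has_derivative (\<lambda>_. 0)) (at x)"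
      by (rule has_derivative_transform_within_open[OF has_derivative_const[of 0]]) (use that F0 in auto)
    with der show ?thesis using has_derivative_unique by blast
  qed
  have "((\<lambda>x. F' x i \<bullet> i) has_integral 0) UNIV" if i: "i \<in> Basis" for i
  proof (rule integral_directional_derivative_eq_0[of "\<lambda>x. F x \<bullet> i" i _ R])
    show "((\<lambda>t. F (x + t *\<^sub>R i) \<bullet> i) has_real_derivative F' (x + t *\<^sub>R i) i \<bullet> i) (at t)" for x t
    proof -
      have "linear (F' (x + t *\<^sub>R i))" using der has_derivative_linear by blast
      moreover have "((\<lambda>t. F (x + t *\<^sub>R i) \<bullet> i) has_derivative (\<lambda>s. F' (x + t *\<^sub>R i) (s *\<^sub>R i) \<bullet> i)) (at t)"
        by (intro has_derivative_inner_left has_derivative_compose[OF _ der])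
          (auto intro!: derivative_eq_intros)
      ultimately show ?thesis unfolding has_field_derivative_def
        by (simp add: linear_cmul mult.commute[of _ "F' (x + t *\<^sub>R i) i \<bullet> i"])
    qed
    show "continuous_on UNIV (\<lambda>x. F x \<bullet> i)"
      by (intro continuous_intros has_derivative_continuous_on) (use der in \<open>auto intro: has_derivative_at_withinI\<close>)
  qed (use F0 F'0 cont i in auto)
  then have "((\<lambda>x. \<Sum>i\<in>Basis. F' x i \<bullet> i) has_integral (\<Sum>i\<in>(Basis::'a set). 0)) UNIV"
    by (intro has_integral_sum) auto
  then show ?thesis by simp
qed

text \<open>The second difference is symmetric in \<open>v\<close> and \<open>w\<close>, so evaluating it by the mean value theorem in either order
  gives the symmetry of the Hessian.\<close>

lemma second_difference_mvt:
  fixes u :: "'a::euclidean_space \<Rightarrow> real"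
  assumes s: "s > 0"
    and du: "\<And>y. y \<in> ball x d \<Longrightarrow> (u has_derivative (\<lambda>v. G y \<bullet> v)) (at y)"
    and dG: "\<And>y. y \<in> ball x d \<Longrightarrow> (G has_derivative H y) (at y)"
    and small: "s * (norm v + norm w) < d"
  shows "\<exists>y\<in>ball x d. u (x + s *\<^sub>R v + s *\<^sub>R w) - u (x + s *\<^sub>R v) - u (x + s *\<^sub>R w) + u x = s\<^sup>2 * (H y w \<bullet> v)"
proof -
  have inb: "x + r *\<^sub>R v + t *\<^sub>R w \<in> ball x d" if "0 \<le> r" "r \<le> s" "0 \<le> t" "t \<le> s" for r t
  proof -
    have "norm (r *\<^sub>R v + t *\<^sub>R w) \<le> r * norm v + t * norm w"
      using that norm_triangle_ineq[of "r *\<^sub>R v" "t *\<^sub>R w"] by simp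
    also have "\<dots> \<le> s * norm v + s * norm w"
      using that by (intro add_mono mult_right_mono) auto
    finally show ?thesis using small
      by (simp add: dist_norm algebra_simps norm_minus_commute)
  qed
  define p where "p r = u (x + r *\<^sub>R v + s *\<^sub>R w) - u (x + r *\<^sub>R v)" for r
  have "\<exists>r. 0 < r \<and> r < s \<and> p s - p 0 = (s - 0) * ((G (x + r *\<^sub>R v + s *\<^sub>R w) - G (x + r *\<^sub>R v)) \<bullet> v)"
  proof (rule MVT2[OF s])
    fix r assume r: "0 \<le> r" "r \<le> s"
    have "x + r *\<^sub>R v + s *\<^sub>R w \<in> ball x d" "x + r *\<^sub>R v \<in> ball x d" using inb[OF r, of s] inb[OF r, of 0] s by auto
    then have "(p has_derivative (\<lambda>h. G (x + r *\<^sub>R v + s *\<^sub>R w) \<bullet> (h *\<^sub>R v) - G (x + r *\<^sub>R v) \<bullet> (h *\<^sub>R v))) (at r)"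
      unfolding p_def
      by (intro has_derivative_diff has_derivative_compose[OF _ du]) (auto intro!: derivative_eq_intros)
    then show "(p has_real_derivative (G (x + r *\<^sub>R v + s *\<^sub>R w) - G (x + r *\<^sub>R v)) \<bullet> v) (at r)"
      by (auto simp: has_field_derivative_def algebra_simps elim!: has_derivative_eq_rhs)
  qed
  then obtain r where r: "0 < r" "r < s" and pr: "p s - p 0 = s * ((G (x + r *\<^sub>R v + s *\<^sub>R w) - G (x + r *\<^sub>R v)) \<bullet> v)" by auto
  have "\<exists>t. 0 < t \<and> t < s \<and> G (x + r *\<^sub>R v + s *\<^sub>R w) \<bullet> v - G (x + r *\<^sub>R v + 0 *\<^sub>R w) \<bullet> v = (s - 0) * (H (x + r *\<^sub>R v + t *\<^sub>R w) w \<bullet> v)"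
  proof (rule MVT2[OF s])
    fix t assume t: "0 \<le> t" "t \<le> s"
    have y: "x + r *\<^sub>R v + t *\<^sub>R w \<in> ball x d" using inb[of r t] r t by auto
    then have "((\<lambda>t. G (x + r *\<^sub>R v + t *\<^sub>R w) \<bullet> v) has_derivative (\<lambda>h. H (x + r *\<^sub>R v + t *\<^sub>R w) (h *\<^sub>R w) \<bullet> v)) (at t)"
      by (intro has_derivative_inner_left has_derivative_compose[OF _ dG]) (auto intro!: derivative_eq_intros)
    moreover have "linear (H (x + r *\<^sub>R v + t *\<^sub>R w))" using dG[OF y] has_derivative_linear by blast
    ultimately show "((\<lambda>t. G (x + r *\<^sub>R v + t *\<^sub>R w) \<bullet> v) has_real_derivative H (x + r *\<^sub>R v + t *\<^sub>R w) w \<bullet> v) (at t)"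
      by (auto simp: has_field_derivative_def linear_cmul mult.commute elim!: has_derivative_eq_rhs)
  qed
  then obtain t where t: "0 < t" "t < s" and "G (x + r *\<^sub>R v + s *\<^sub>R w) \<bullet> v - G (x + r *\<^sub>R v) \<bullet> v = s * (H (x + r *\<^sub>R v + t *\<^sub>R w) w \<bullet> v)" by auto
  with pr have "p s - p 0 = s\<^sup>2 * (H (x + r *\<^sub>R v + t *\<^sub>R w) w \<bullet> v)" by (simp add: inner_diff_left power2_eq_square)
  moreover have "x + r *\<^sub>R v + t *\<^sub>R w \<in> ball x d" using inb[of r t] r t by auto
  ultimately show ?thesis unfolding p_def by (intro bexI) (auto simp: algebra_simps)
qed

lemma hessian_symmetric:
  fixes u :: "'a::euclidean_space \<Rightarrow> real"
  assumes S: "open S" "x \<in> S"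
    and du: "\<And>y. y \<in> S \<Longrightarrow> (u has_derivative (\<lambda>v. G y \<bullet> v)) (at y)"
    and dG: "\<And>y. y \<in> S \<Longrightarrow> (G has_derivative H y) (at y)"
    and cH: "\<And>v. continuous_on S (\<lambda>y. H y v)"
  shows "H x v \<bullet> w = H x w \<bullet> v"
proof (rule ccontr)
  assume ne: "H x v \<bullet> w \<noteq> H x w \<bullet> v"
  \<comment> \<open>Half the supposed gap: two evaluations, each within \<open>e\<close> of its
    value at \<open>x\<close>, would have to agree.\<close>
  define e where "e = \<bar>H x v \<bullet> w - H x w \<bullet> v\<bar> / 2"
  have e: "e > 0" using ne by (simp add: e_def)
  have near: "\<exists>d>0. \<forall>y\<in>ball x d. y \<in> S \<and> \<bar>H y v \<bullet> w - H x v \<bullet> w\<bar> < e" for v w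
  proof -
    have "continuous_on S (\<lambda>y. H y v \<bullet> w)" by (intro continuous_intros cH)
    then have "isCont (\<lambda>y. H y v \<bullet> w) x" using S continuous_on_eq_continuous_at by blast
    then obtain d1 where "d1 > 0" "\<And>y. dist y x < d1 \<Longrightarrow> dist (H y v \<bullet> w) (H x v \<bullet> w) < e"
      using e unfolding continuous_at_eps_delta by blast
    moreover obtain d2 where "d2 > 0" "ball x d2 \<subseteq> S" using S open_contains_ball by blast
    ultimately show ?thesis
      by (intro exI[of _ "min d1 d2"]) (auto simp: dist_real_def dist_commute subset_iff)
  qed
  obtain d1 d2 where d12: "d1 > 0" "d2 > 0" "\<forall>y\<in>ball x d1. y \<in> S \<and> \<bar>H y v \<bullet> w - H x v \<bullet> w\<bar> < e"
    "\<forall>y\<in>ball x d2. y \<in> S \<and> \<bar>H y w \<bullet> v - H x w \<bullet> v\<bar> < e"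
    using near[of v w] near[of w v] by blast
  define d where "d = min d1 d2"
  \<comment> \<open>The summand 1 keeps the denominator positive when \<open>v\<close> and
    \<open>w\<close> are both zero.\<close>
  define s where "s = d / (2 * (norm v + norm w + 1))"
  have d: "d > 0" using d12 by (simp add: d_def)
  have nn: "norm v + norm w + 1 > 0" by (simp add: add_nonneg_pos)
  have s: "s > 0" using d nn by (simp add: s_def)
  have "s * (norm v + norm w) < s * (2 * (norm v + norm w + 1))" using s nn by (intro mult_strict_left_mono) auto
  also have "\<dots> = d" using nn by (simp add: s_def)
  finally have small: "s * (norm v + norm w) < d" .
  have inS: "y \<in> S" if "y \<in> ball x d" for y using that d12 by (auto simp: d_def)
  obtain y where y: "y \<in> ball x d" "u (x + s *\<^sub>R v + s *\<^sub>R w) - u (x + s *\<^sub>R v) - u (x + s *\<^sub>R w) + u x = s\<^sup>2 * (H y w \<bullet> v)"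
    using second_difference_mvt[OF s _ _ small, of x u G H] du dG inS by blast
  obtain z where z: "z \<in> ball x d" "u (x + s *\<^sub>R w + s *\<^sub>R v) - u (x + s *\<^sub>R w) - u (x + s *\<^sub>R v) + u x = s\<^sup>2 * (H z v \<bullet> w)"
    using second_difference_mvt[OF s, of x d u G H w v] du dG inS small by (auto simp: add.commute)
  have "s\<^sup>2 * (H y w \<bullet> v) = s\<^sup>2 * (H z v \<bullet> w)" using y(2) z(2) by (simp add: algebra_simps)
  then have "H y w \<bullet> v = H z v \<bullet> w" using s by simp
  moreover have "\<bar>H y w \<bullet> v - H x w \<bullet> v\<bar> < e" "\<bar>H z v \<bullet> w - H x v \<bullet> w\<bar> < e"
    using y(1) z(1) d12 by (auto simp: d_def)
  moreover have "\<bar>A - B\<bar> < 2 * e" if "C = C'" "\<bar>C - A\<bar> < e" "\<bar>C' - B\<bar> < e" for A B C C' :: real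
    using that by linarith
  ultimately have "\<bar>H x w \<bullet> v - H x v \<bullet> w\<bar> < 2 * e" by blast
  then show False by (simp add: e_def abs_minus_commute)
qed

section \<open>Derivatives of truncated squares and of powers of the absolute value\<close>

text \<open>At 0 the difference quotient is at most |h|. Truncated squares are the building block of
  all cutoffs here: a cutoff is differentiated only once, so C1 regularity suffices.\<close>

lemma has_real_derivative_max_0_squared: "((\<lambda>t::real. (max 0 t)\<^sup>2) has_real_derivative 2 * max 0 x) (at x)"
proof -
  consider "x < 0" | "x > 0" | "x = 0" by linarith
  then show ?thesis
  proof cases
    case 1
    have "((\<lambda>_. 0) has_real_derivative 0) (at x)" by simp
    then have "((\<lambda>t::real. (max 0 t)\<^sup>2) has_real_derivative 0) (at x)"
      by (rule has_field_derivative_transform_within_open[of _ _ _ "{..<0}"]) (use 1 in auto)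
    then show ?thesis using 1 by simp
  next
    case 2
    have "((\<lambda>t. t\<^sup>2) has_real_derivative 2 * x) (at x)" by (auto intro!: derivative_eq_intros)
    then have "((\<lambda>t::real. (max 0 t)\<^sup>2) has_real_derivative 2 * x) (at x)"
      by (rule has_field_derivative_transform_within_open[of _ _ _ "{0<..}"]) (use 2 in auto)
    then show ?thesis using 2 by simp
  next
    case 3
    have "((\<lambda>h::real. (max 0 h)\<^sup>2 / h) \<longlongrightarrow> 0) (at 0)"
    proof (rule tendsto_0_le[where f="\<lambda>h. h" and K=1])
      show "\<forall>\<^sub>F h in at 0. norm ((max 0 h)\<^sup>2 / h) \<le> norm (h::real) * 1"
        by (intro always_eventually) (auto simp: max_def divide_simps power2_eq_square)
    qed (rule tendsto_ident_at)
    then show ?thesis using 3 by (simp add: DERIV_def)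
  qed
qed

text \<open>Away from 0 this is the power rule on each side; at 0 the difference quotient has
  absolute value \<open>\<bar>h\<bar> powr (p - 1)\<close>. The derivative is written so that the
  nonlinearity of the equation appears verbatim.\<close>

lemma has_real_derivative_abs_powr:
  assumes p: "p > (2::real)"
  shows "((\<lambda>t::real. \<bar>t\<bar> powr p) has_real_derivative p * (\<bar>x\<bar> powr (p - 2) * x)) (at x)"
proof -
  consider "x < 0" | "x > 0" | "x = 0" by linarith
  then show ?thesis
  proof cases
    case 1
    have "((\<lambda>t. (- t) powr p) has_real_derivative p * ((-x) powr (p - 2) * x)) (at x)"
    proof -
      have "(-x) powr (p - 1) = - (x * (-x) powr (p - 2))" using powr_mult_base[of "-x" "p - 2"] 1 by simp
      then show ?thesis using 1 by (auto intro!: derivative_eq_intros)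
    qed
    then have "((\<lambda>t. \<bar>t\<bar> powr p) has_real_derivative p * ((-x) powr (p - 2) * x)) (at x)"
      by (rule has_field_derivative_transform_within_open[of _ _ _ "{..<0}"]) (use 1 in auto)
    then show ?thesis using 1 by simp
  next
    case 2
    have "((\<lambda>t. t powr p) has_real_derivative p * (x powr (p - 2) * x)) (at x)"
      using 2 powr_mult_base[of "x" "p - 2"] by (auto intro!: derivative_eq_intros simp: algebra_simps)
    then have "((\<lambda>t. \<bar>t\<bar> powr p) has_real_derivative p * (x powr (p - 2) * x)) (at x)"
      by (rule has_field_derivative_transform_within_open[of _ _ _ "{0<..}"]) (use 2 in auto)
    then show ?thesis using 2 by simp
  next
    case 3
    have "((\<lambda>h::real. \<bar>h\<bar> powr p / h) \<longlongrightarrow> 0) (at 0)"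
    proof (rule tendsto_0_le[where f="\<lambda>h. \<bar>h\<bar> powr (p - 1)" and K=1])
      show "\<forall>\<^sub>F h in at 0. norm (\<bar>h\<bar> powr p / h) \<le> norm (\<bar>h\<bar> powr (p - 1)) * (1::real)"
        using eventually_neq_at_within by eventually_elim (auto simp: powr_diff)
      have "((\<lambda>h::real. \<bar>h\<bar> powr (p - 1)) \<longlongrightarrow> \<bar>0\<bar> powr (p - 1)) (at 0)"
        using p by (intro tendsto_powr' tendsto_intros) auto
      then show "((\<lambda>h::real. \<bar>h\<bar> powr (p - 1)) \<longlongrightarrow> 0) (at 0)" by simp
    qed
    then show ?thesis using 3 by (simp add: DERIV_def)
  qed
qed

text \<open>Since \<open>w\<close> vanishes on an open set \<open>U\<close> covering the complement
  of \<open>S\<close>, the product \<open>w F\<close> extends by zero to a differentiable field with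
  bounded support on the whole space. Its divergence is \<open>w\<close> times that of
  \<open>F\<close> plus the derivative of \<open>w\<close> along \<open>F\<close>; the second term
  will carry the boundary information.\<close>

lemma integral_cutoff_divergence:
  fixes F :: "'a::euclidean_space \<Rightarrow> 'a" and w :: "'a \<Rightarrow> real"
  assumes S: "open S" "open U" "S \<union> U = UNIV"
    and dw: "\<And>x. (w has_derivative w' x) (at x)"
    and cw: "\<And>v. continuous_on UNIV (\<lambda>x. w' x v)"
    and wU: "\<And>x. x \<in> U \<Longrightarrow> w x = 0"
    and w0: "\<And>x. x \<in> S \<Longrightarrow> norm x > R \<Longrightarrow> w x = 0"
    and der: "\<And>x. x \<in> S \<Longrightarrow> (F has_derivative F' x) (at x)"
    and cont: "\<And>i. i \<in> Basis \<Longrightarrow> continuous_on S (\<lambda>x. F' x i \<bullet> i)"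
  shows "((\<lambda>x. w x * (\<Sum>i\<in>Basis. F' x i \<bullet> i) + w' x (F x)) has_integral 0) S"
proof -
  have w'U: "w' x = (\<lambda>_. 0)" if "x \<in> U" for x
  proof -
    have "(w has_derivative (\<lambda>_. 0)) (at x)"
      by (rule has_derivative_transform_within_open[OF has_derivative_const[of 0] S(2) that]) (simp add: wU)
    with dw show ?thesis using has_derivative_unique by blast
  qed
  define P where "P x = (if x \<in> S then w x *\<^sub>R F x else 0)" for x
  define P' where "P' x v = (if x \<in> S then w x *\<^sub>R F' x v + w' x v *\<^sub>R F x else 0)" for x v
  have P0: "P x = 0" "P' x v = 0" if "x \<in> U" for x v
    using that by (auto simp: P_def P'_def wU w'U)
  have "((\<lambda>x. \<Sum>i\<in>Basis. P' x i \<bullet> i) has_integral 0) UNIV"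
  proof (rule integral_divergence_eq_0)
    fix x
    show "(P has_derivative P' x) (at x)"
    proof (cases "x \<in> S")
      case True
      have "((\<lambda>x. w x *\<^sub>R F x) has_derivative (\<lambda>v. w x *\<^sub>R F' x v + w' x v *\<^sub>R F x)) (at x)"
        by (intro has_derivative_scaleR dw der True)
      then have "(P has_derivative (\<lambda>v. w x *\<^sub>R F' x v + w' x v *\<^sub>R F x)) (at x)"
        by (rule has_derivative_transform_within_open[OF _ S(1) True]) (simp add: P_def)
      moreover have "P' x = (\<lambda>v. w x *\<^sub>R F' x v + w' x v *\<^sub>R F x)" using True by (auto simp: P'_def)
      ultimately show ?thesis by simp
    next
      case False
      then have x: "x \<in> U" using S by blast
      have "(P has_derivative (\<lambda>_. 0)) (at x)"
        by (rule has_derivative_transform_within_open[OF has_derivative_const[of 0] S(2) x]) (simp add: P0)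
      moreover have "P' x = (\<lambda>_. 0)" using P0(2)[OF x] by auto
      ultimately show ?thesis by simp
    qed
  next
    fix i :: 'a assume i: "i \<in> Basis"
    have "continuous_on S (\<lambda>x. (w x *\<^sub>R F' x i + w' x i *\<^sub>R F x) \<bullet> i)"
    proof -
      have "continuous_on S F" using der
        by (intro has_derivative_continuous_on) (auto intro: has_derivative_at_withinI)
      moreover have "continuous_on S w" using dw
        by (intro has_derivative_continuous_on) (auto intro: has_derivative_at_withinI)
      moreover have "continuous_on S (\<lambda>x. w' x i)" using cw continuous_on_subset by blast
      ultimately show ?thesis using cont[OF i]
        by (auto simp: inner_add_left intro!: continuous_intros)
    qed
    then have "continuous_on S (\<lambda>x. P' x i \<bullet> i)"
      by (rule continuous_on_eq) (simp add: P'_def)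
    moreover have "continuous_on U (\<lambda>x. P' x i \<bullet> i)"
      by (rule continuous_on_eq[OF continuous_on_const[of _ 0]]) (simp add: P0)
    ultimately show "continuous_on UNIV (\<lambda>x. P' x i \<bullet> i)"
      using continuous_on_open_Un[OF S(1,2)] S(3) by metis
  next
    show "P x = 0" if "norm x > R" for x using that by (simp add: P_def w0)
  qed
  moreover have "(\<Sum>i\<in>Basis. P' x i \<bullet> i) = (if x \<in> S then w x * (\<Sum>i\<in>Basis. F' x i \<bullet> i) + w' x (F x) else 0)" for x
  proof -
    have "linear (w' x)" using dw has_derivative_linear by blast
    then have "w' x (F x) = (\<Sum>i\<in>Basis. w' x i * (F x \<bullet> i))"
      by (subst euclidean_representation[symmetric, of "F x"])
        (simp add: linear_sum linear_cmul mult.commute del: euclidean_representation_sum)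
    then show ?thesis
      by (simp add: P'_def inner_add_left sum.distrib sum_distrib_left)
  qed
  ultimately show ?thesis by (simp add: has_integral_restrict_UNIV)
qed

section \<open>Cutoff functions\<close>

text \<open>The antiderivative of the hat function on [0, 2] with peak 1 at 1, whose area is 1.
  Writing it as a second difference of truncated squares avoids case distinctions in the
  derivative.\<close>

definition c1_step :: "real \<Rightarrow> real" where
  "c1_step t = ((max 0 t)\<^sup>2 - 2 * (max 0 (t - 1))\<^sup>2 + (max 0 (t - 2))\<^sup>2) / 2"

definition c1_step_deriv :: "real \<Rightarrow> real" where
  "c1_step_deriv t = max 0 t - 2 * max 0 (t - 1) + max 0 (t - 2)"

lemma c1_step_has_derivative: "(c1_step has_real_derivative c1_step_deriv t) (at t)"
proof -
  have "((\<lambda>t. (max 0 (t - c))\<^sup>2) has_real_derivative 2 * max 0 (t - c)) (at t)" for c :: real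
    using DERIV_chain2[OF has_real_derivative_max_0_squared, of "\<lambda>t. t - c" 1 t UNIV]
    by (simp add: DERIV_diff[OF DERIV_ident DERIV_const, simplified])
  note d = this[of 0, simplified] this[of 1] this[of 2]
  show ?thesis unfolding c1_step_def c1_step_deriv_def
    by (rule derivative_eq_intros d refl | simp)+
qed

lemma c1_step_deriv_nonneg: "c1_step_deriv t \<ge> 0"
  by (auto simp: c1_step_deriv_def max_def)

lemma c1_step_deriv_eq_0: "t \<ge> 2 \<Longrightarrow> c1_step_deriv t = 0"
  by (simp add: c1_step_deriv_def max_def)

lemma c1_step_eq_0: "t \<le> 0 \<Longrightarrow> c1_step t = 0"
  by (simp add: c1_step_def max_def)

lemma c1_step_eq_1: "t \<ge> 2 \<Longrightarrow> c1_step t = 1"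
  by (simp add: c1_step_def max_def field_simps power2_eq_square)

lemma c1_step_mono: "s \<le> t \<Longrightarrow> c1_step s \<le> c1_step t"
  by (rule DERIV_nonneg_imp_nondecreasing) (use c1_step_has_derivative c1_step_deriv_nonneg in blast)+

lemma c1_step_bounds: "0 \<le> c1_step t" "c1_step t \<le> 1"
  using c1_step_mono[of "min 0 t" t] c1_step_eq_0[of "min 0 t"] c1_step_mono[of t "max 2 t"] c1_step_eq_1[of "max 2 t"] by auto

lemma continuous_c1_step_deriv [continuous_intros]:
  "continuous_on S f \<Longrightarrow> continuous_on S (\<lambda>x. c1_step_deriv (f x))"
  unfolding c1_step_deriv_def by (intro continuous_intros)

lemma continuous_c1_step [continuous_intros]:
  "continuous_on S f \<Longrightarrow> continuous_on S (\<lambda>x. c1_step (f x))"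
  unfolding c1_step_def by (intro continuous_intros) auto

text \<open>A cutoff in \<open>z\<close> without a plateau is good enough: it increases to 1 as \<open>R\<close> grows, and its gradient is at most
  \<open>4 |z| / R\<^sup>2\<close> on the ball of radius \<open>R\<close> and vanishes outside.\<close>

definition bump :: "real \<Rightarrow> 'b::euclidean_space \<Rightarrow> real" where
  "bump R z = (max 0 (1 - (z \<bullet> z) / R\<^sup>2))\<^sup>2"

definition bump_deriv :: "real \<Rightarrow> 'b::euclidean_space \<Rightarrow> 'b \<Rightarrow> real" where
  "bump_deriv R z v = - (4 * max 0 (1 - (z \<bullet> z) / R\<^sup>2) / R\<^sup>2) * (z \<bullet> v)"

lemma bump_has_derivative: "(bump R has_derivative bump_deriv R z) (at z)"
proof -
  have "((\<lambda>z. (max 0 (1 - (z \<bullet> z) / R\<^sup>2))\<^sup>2) has_derivative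
      (\<lambda>v. (2 * max 0 (1 - (z \<bullet> z) / R\<^sup>2)) * (- ((z \<bullet> v + v \<bullet> z) / R\<^sup>2)))) (at z)"
    by (rule has_derivative_compose[OF _ has_real_derivative_max_0_squared[unfolded has_field_derivative_def]])
      (auto intro!: derivative_eq_intros simp: divide_inverse)
  moreover have "(\<lambda>v. (2 * max 0 (1 - (z \<bullet> z) / R\<^sup>2)) * (- ((z \<bullet> v + v \<bullet> z) / R\<^sup>2))) = bump_deriv R z"
    by (auto simp: bump_deriv_def inner_commute)
  ultimately show ?thesis by (simp add: bump_def[abs_def])
qed

lemma continuous_bump [continuous_intros]:
  "continuous_on S f \<Longrightarrow> continuous_on S (\<lambda>x. bump R (f x))"
  unfolding bump_def divide_inverse by (intro continuous_intros) auto

lemma continuous_bump_deriv [continuous_intros]: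
  "continuous_on S f \<Longrightarrow> continuous_on S g \<Longrightarrow> continuous_on S (\<lambda>x. bump_deriv R (f x) (g x))"
  unfolding bump_deriv_def divide_inverse by (intro continuous_intros) auto

lemma bump_outside:
  assumes "R > 0" "norm z \<ge> R"
  shows "bump R z = 0" "bump_deriv R z v = 0"
proof -
  have "R\<^sup>2 \<le> z \<bullet> z" using assms by (simp add: dot_square_norm power_mono)
  then have "1 - (z \<bullet> z) / R\<^sup>2 \<le> 0" using assms by simp
  then show "bump R z = 0" "bump_deriv R z v = 0" by (auto simp: bump_def bump_deriv_def max_def)
qed

lemma bump_bounds: "0 \<le> bump R z" "bump R z \<le> 1"
proof -
  have "max 0 (1 - (z \<bullet> z) / R\<^sup>2) \<le> 1" by simp
  then show "bump R z \<le> 1" unfolding bump_def by (intro power_le_one) auto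
qed (simp add: bump_def)

lemma bump_mono:
  assumes "0 < R" "R \<le> R'"
  shows "bump R z \<le> bump R' z"
proof -
  have "(z \<bullet> z) / R'\<^sup>2 \<le> (z \<bullet> z) / R\<^sup>2" using assms by (intro divide_left_mono power_mono) auto
  then show ?thesis unfolding bump_def by (intro power_mono) auto
qed

section \<open>Fluxes through the boundary of an annular cylinder\<close>

locale annular_cylinder =
  fixes a b :: real and \<Omega> :: "('a::euclidean_space \<times> 'b::euclidean_space) set"
  assumes ab: "0 < a" "a < b"
    and Omega_def: "\<Omega> = {(y, z). a < norm y \<and> norm y < b}"
begin

lemma in_Omega: "x \<in> \<Omega> \<longleftrightarrow> a < norm (fst x) \<and> norm (fst x) < b"
  by (auto simp: Omega_def split: prod.splits)

lemma open_Omega: "open \<Omega>"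
proof -
  have "\<Omega> = {x. a < norm (fst x)} \<inter> {x. norm (fst x) < b}" by (auto simp: in_Omega)
  then show ?thesis by (auto intro!: open_Int open_Collect_less continuous_intros)
qed

lemma closure_Omega_le: "x \<in> closure \<Omega> \<Longrightarrow> a \<le> norm (fst x) \<and> norm (fst x) \<le> b"
proof -
  have "closed {x::'a \<times> 'b. a \<le> norm (fst x) \<and> norm (fst x) \<le> b}"
    by (intro closed_Collect_conj closed_Collect_le continuous_intros)
  then have "closure \<Omega> \<subseteq> {x. a \<le> norm (fst x) \<and> norm (fst x) \<le> b}"
    by (intro closure_minimal) (auto simp: in_Omega)
  then show "x \<in> closure \<Omega> \<Longrightarrow> a \<le> norm (fst x) \<and> norm (fst x) \<le> b" by blast
qed

lemma compact_slice: "compact {x \<in> closure \<Omega>. norm (snd x) \<le> R}"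
proof (rule compact_eq_bounded_closed[THEN iffD2], rule conjI)
  have "norm x \<le> b + R" if "x \<in> closure \<Omega>" "norm (snd x) \<le> R" for x
    using closure_Omega_le[OF that(1)] that(2) norm_Pair_le[of "fst x" "snd x"] by simp
  then show "bounded {x \<in> closure \<Omega>. norm (snd x) \<le> R}" unfolding bounded_iff by blast
  have "closed (closure \<Omega> \<inter> {x. norm (snd x) \<le> R})"
    by (intro closed_Int closed_Collect_le continuous_intros) auto
  then show "closed {x \<in> closure \<Omega>. norm (snd x) \<le> R}" by (simp add: Collect_conj_eq)
qed

lemma integrable_on_Omega:
  fixes f :: "'a \<times> 'b \<Rightarrow> real"
  assumes "continuous_on (closure \<Omega>) f" "\<And>x. x \<in> \<Omega> \<Longrightarrow> norm (snd x) > R \<Longrightarrow> f x = 0"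
  shows "f integrable_on \<Omega>"
proof -
  let ?K = "{x \<in> closure \<Omega>. norm (snd x) \<le> R}"
  have "integrable lborel (\<lambda>x. indicator ?K x *\<^sub>R f x)"
    using assms(1) by (intro borel_integrable_compact compact_slice) (auto intro: continuous_on_subset)
  then have "integrable lborel (\<lambda>x. indicator \<Omega> x *\<^sub>R (indicator ?K x *\<^sub>R f x))"
    by (rule integrable_mult_indicator[rotated]) (simp add: open_Omega)
  moreover have "indicator \<Omega> x *\<^sub>R (indicator ?K x *\<^sub>R f x) = (if x \<in> \<Omega> then f x else 0)" for x
    using assms(2)[of x] closure_subset[of \<Omega>] by (auto simp: indicator_def not_less[symmetric])
  ultimately have "integrable lborel (\<lambda>x. if x \<in> \<Omega> then f x else 0)" by simp
  then show ?thesis using integrable_on_lborel integrable_restrict_UNIV by blast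
qed

text \<open>The points with |z| \<le> R at which \<open>g\<close> is not positive form a compact
  set, on which \<open>r\<close> attains a positive minimum; this minimum is the thickness
  \<open>m\<close>. The restriction to |z| \<le> R supplies the compactness, and the cutoff
  \<open>bump R\<close> later confines everything to that region.\<close>

lemma positive_near_boundary:
  assumes g: "continuous_on (closure \<Omega>) g" and r: "continuous_on (closure \<Omega>) r"
    and r0: "\<And>x. x \<in> closure \<Omega> \<Longrightarrow> r x \<ge> (0::real)"
    and pos: "\<And>x. x \<in> closure \<Omega> \<Longrightarrow> r x = 0 \<Longrightarrow> g x > (0::real)"
  shows "\<exists>m>0. \<forall>x\<in>closure \<Omega>. norm (snd x) \<le> R \<longrightarrow> r x < m \<longrightarrow> g x > 0"
proof -
  let ?K = "{x \<in> closure \<Omega>. norm (snd x) \<le> R}"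
  let ?C = "?K \<inter> g -` {..0}"
  have "closed ?C"
    by (rule continuous_on_closed_vimage[THEN iffD1, rule_format, THEN subst[of _ _ closed, OF Int_commute]])
      (use g compact_slice in \<open>auto intro: continuous_on_subset compact_imp_closed\<close>)
  then have C: "compact ?C" using compact_slice by (metis compact_Int_closed inf.left_idem)
  show ?thesis
  proof (cases "?C = {}")
    case True
    then show ?thesis by (intro exI[of _ 1]) (auto simp: not_le[symmetric])
  next
    case False
    have "continuous_on ?C r" using r by (rule continuous_on_subset) auto
    then obtain c where c: "c \<in> ?C" "\<forall>x\<in>?C. r c \<le> r x" using continuous_attains_inf[OF C False] by blast
    have "r c \<noteq> 0" using pos[of c] c(1) by auto
    then have "r c > 0" using r0[of c] c(1) by auto
    then show ?thesis using c(2) by (intro exI[of _ "r c"]) (force simp: not_le[symmetric])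
  qed
qed

text \<open>No trace on the boundary is needed: with cutoffs \<open>e n\<close> supported away from the boundary, the strict signs in
  \<open>out\<close> and \<open>inn\<close> persist on the thin shells where the gradient of \<open>e n\<close> lives, which fixes the sign of the error term.\<close>

lemma flux_nonneg_strict:
  fixes F :: "'a \<times> 'b \<Rightarrow> 'a \<times> 'b"
  assumes contF: "continuous_on (closure \<Omega>) F"
    and der: "\<And>x. x \<in> \<Omega> \<Longrightarrow> (F has_derivative F' x) (at x)"
    and cont: "\<And>i. i \<in> Basis \<Longrightarrow> continuous_on \<Omega> (\<lambda>x. F' x i \<bullet> i)"
    and div: "\<And>x. x \<in> \<Omega> \<Longrightarrow> (\<Sum>i\<in>Basis. F' x i \<bullet> i) = D x"
    and contD: "continuous_on (closure \<Omega>) D"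
    and out: "\<And>x. x \<in> closure \<Omega> \<Longrightarrow> norm (fst x) = b \<Longrightarrow> fst x \<bullet> fst (F x) > 0"
    and inn: "\<And>x. x \<in> closure \<Omega> \<Longrightarrow> norm (fst x) = a \<Longrightarrow> fst x \<bullet> fst (F x) < 0"
    and R: "R > 0"
  shows "0 \<le> integral \<Omega> (\<lambda>x. bump R (snd x) * D x + bump_deriv R (snd x) (snd (F x)))"
proof -
  define I where "I x = bump R (snd x) * D x + bump_deriv R (snd x) (snd (F x))" for x
  \<comment> \<open>The cutoff \<open>e n\<close> vanishes where \<open>|y|\<^sup>2\<close> is
    within 1/n of \<open>a\<^sup>2\<close> or \<open>b\<^sup>2\<close> and equals 1 where both
    distances are at least 3/n; the shift by 1 makes it vanish on an open neighbourhood of the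
    complement. Squared radii keep it differentiable at y = 0 as well.\<close>
  define A where "A n x = real n * (b\<^sup>2 - fst x \<bullet> fst x) - 1" for n and x :: "'a \<times> 'b"
  define B where "B n x = real n * (fst x \<bullet> fst x - a\<^sup>2) - 1" for n and x :: "'a \<times> 'b"
  define e where "e n x = c1_step (A n x) * c1_step (B n x)" for n x
  define T where "T n x v = 2 * real n * (fst x \<bullet> fst v) * (c1_step (A n x) * c1_step_deriv (B n x) - c1_step_deriv (A n x) * c1_step (B n x))"
    for n and x v :: "'a \<times> 'b"
  have contI: "continuous_on (closure \<Omega>) I"
    unfolding I_def by (intro continuous_intros contF contD)
  have conte: "continuous_on S (e n)" for n S
    unfolding e_def A_def B_def by (intro continuous_intros)
  have I0: "I x = 0" if "norm (snd x) > R" for x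
    using bump_outside[OF R, of "snd x"] that by (simp add: I_def)
  have intI: "I integrable_on \<Omega>" by (rule integrable_on_Omega[OF contI]) (rule I0)
  have inteI: "(\<lambda>x. e n x * I x) integrable_on \<Omega>" for n
    by (rule integrable_on_Omega[of _ R]) (use I0 conte contI in \<open>auto intro!: continuous_intros\<close>)
  have de: "(e n has_derivative T n x) (at x)" for n x
  proof -
    have dA: "(A n has_derivative (\<lambda>v. - 2 * real n * (fst x \<bullet> fst v))) (at x)"
      unfolding A_def by (rule derivative_eq_intros refl | simp add: inner_commute algebra_simps)+
    have dB: "(B n has_derivative (\<lambda>v. 2 * real n * (fst x \<bullet> fst v))) (at x)"
      unfolding B_def by (rule derivative_eq_intros refl | simp add: inner_commute algebra_simps)+
    note st = c1_step_has_derivative[unfolded has_field_derivative_def]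
    show ?thesis unfolding e_def
      by (rule has_derivative_eq_rhs[OF has_derivative_mult[OF has_derivative_compose[OF dA st] has_derivative_compose[OF dB st]]])
        (auto simp: T_def algebra_simps)
  qed
  have key: "((\<lambda>x. e n x * I x + bump R (snd x) * T n x (F x)) has_integral 0) \<Omega>" if n: "n > 0" for n
  proof -
    let ?w = "\<lambda>x. e n x * bump R (snd x)"
    let ?w' = "\<lambda>x v. e n x * bump_deriv R (snd x) (snd v) + T n x v * bump R (snd x)"
    let ?U = "{x::'a\<times>'b. A n x < 0} \<union> {x. B n x < 0}"
    have "((\<lambda>x. ?w x * (\<Sum>i\<in>Basis. F' x i \<bullet> i) + ?w' x (F x)) has_integral 0) \<Omega>"
    proof (rule integral_cutoff_divergence[OF open_Omega, where U="?U" and R="b + R" and w="?w" and w'="?w'"])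
      show "open ?U" unfolding A_def B_def by (intro open_Un open_Collect_less continuous_intros)
      have "A n x < 0 \<or> B n x < 0" if "x \<notin> \<Omega>" for x
      proof -
        have "norm (fst x) \<ge> b \<or> norm (fst x) \<le> a" using that by (auto simp: in_Omega)
        then have "fst x \<bullet> fst x \<ge> b\<^sup>2 \<or> fst x \<bullet> fst x \<le> a\<^sup>2"
          using ab by (auto simp: dot_square_norm power_mono)
        then show ?thesis
          using mult_nonneg_nonpos[of n "b\<^sup>2 - fst x \<bullet> fst x"] mult_nonneg_nonpos[of n "fst x \<bullet> fst x - a\<^sup>2"]
          by (auto simp: A_def B_def)
      qed
      then show "\<Omega> \<union> ?U = UNIV" by auto
      have "((\<lambda>x. bump R (snd x)) has_derivative (\<lambda>v. bump_deriv R (snd x) (snd v))) (at x)" for x :: "'a \<times> 'b"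
        by (rule has_derivative_compose[OF _ bump_has_derivative]) (auto intro!: derivative_eq_intros)
      then show "(?w has_derivative ?w' x) (at x)" for x
        by (rule has_derivative_mult[OF de])
      show "continuous_on UNIV (\<lambda>x. ?w' x v)" for v
        unfolding T_def A_def B_def by (intro continuous_intros conte)
      show "?w x = 0" if "x \<in> ?U" for x using that by (auto simp: e_def c1_step_eq_0)
      show "?w x = 0" if "x \<in> \<Omega>" "norm x > b + R" for x
      proof -
        have "norm (snd x) \<ge> R" using that norm_Pair_le[of "fst x" "snd x"] by (auto simp: in_Omega)
        then show ?thesis using bump_outside[OF R, of "snd x"] by simp
      qed
    qed (use der cont in auto)
    then show ?thesis
      by (rule has_integral_eq[rotated]) (simp add: div I_def algebra_simps)
  qed
  have "continuous_on (closure \<Omega>) (\<lambda>x. fst x \<bullet> fst (F x))" by (intro continuous_intros contF)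
  note near = positive_near_boundary[OF this] positive_near_boundary[OF continuous_on_minus[OF this]]
  have sq: "fst x \<bullet> fst x \<le> b\<^sup>2" "a\<^sup>2 \<le> fst x \<bullet> fst x" if "x \<in> closure \<Omega>" for x
    using closure_Omega_le[OF that] ab by (auto simp: dot_square_norm power_mono)
  have norm_eq: "norm y = c" if "y \<bullet> y = c\<^sup>2" "c > 0" for y :: 'a and c
    using that by (simp add: norm_eq_sqrt_inner)
  have "\<exists>m>0. \<forall>x\<in>closure \<Omega>. norm (snd x) \<le> R \<longrightarrow> b\<^sup>2 - fst x \<bullet> fst x < m \<longrightarrow> fst x \<bullet> fst (F x) > 0"
    by (rule near(1)) (use sq out norm_eq ab in \<open>auto intro!: continuous_intros\<close>)
  then obtain m1 where m1: "m1 > 0" "\<And>x. x \<in> closure \<Omega> \<Longrightarrow> norm (snd x) \<le> R \<Longrightarrow> b\<^sup>2 - fst x \<bullet> fst x < m1 \<Longrightarrow> fst x \<bullet> fst (F x) > 0"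
    by blast
  have "\<exists>m>0. \<forall>x\<in>closure \<Omega>. norm (snd x) \<le> R \<longrightarrow> fst x \<bullet> fst x - a\<^sup>2 < m \<longrightarrow> - (fst x \<bullet> fst (F x)) > 0"
    by (rule near(2)) (use sq inn norm_eq ab in \<open>auto intro!: continuous_intros\<close>)
  then obtain m2 where m2: "m2 > 0" "\<And>x. x \<in> closure \<Omega> \<Longrightarrow> norm (snd x) \<le> R \<Longrightarrow> fst x \<bullet> fst x - a\<^sup>2 < m2 \<Longrightarrow> fst x \<bullet> fst (F x) < 0"
    by fastforce
  \<comment> \<open>The gradient of \<open>e n\<close> lives where \<open>A n x\<close> or
    \<open>B n x\<close> is below 2, hence in shells of squared-radius width 3/n, which must fit
    into the thicknesses \<open>m1\<close> and \<open>m2\<close>.\<close>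
  obtain n0 :: nat where n0: "3 / min m1 m2 < real n0" using reals_Archimedean2 by blast
  have nonneg: "0 \<le> integral \<Omega> (\<lambda>x. e n x * I x)" if n: "n \<ge> n0" for n
  proof -
    have m: "min m1 m2 > 0" using m1 m2 by simp
    then have n1: "real n > 0" using n0 n by (meson divide_pos_pos less_le_trans less_trans of_nat_le_iff zero_less_numeral)
    have nm: "3 < real n * m1" "3 < real n * m2"
    proof -
      have "3 < real n0 * min m1 m2" using n0 m by (simp add: pos_divide_less_eq mult.commute)
      moreover have "real n0 * min m1 m2 \<le> real n * min m1 m2" using n m by (intro mult_right_mono) auto
      ultimately have "3 < real n * min m1 m2" by linarith
      moreover have "real n * min m1 m2 \<le> real n * m1" "real n * min m1 m2 \<le> real n * m2" using n1 by auto
      ultimately show "3 < real n * m1" "3 < real n * m2" by linarith+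
    qed
    \<comment> \<open>On the outer shell \<open>e n\<close> decreases outwards while
      \<open>F\<close> points outwards; on the inner shell both signs are reversed. So
      \<open>F\<close> runs down the slope of \<open>e n\<close> on either shell.\<close>
    have le0: "bump R (snd x) * T n x (F x) \<le> 0" if x: "x \<in> \<Omega>" for x
    proof (cases "norm (snd x) \<le> R")
      case True
      have xc: "x \<in> closure \<Omega>" using x closure_subset by blast
      have t1: "(fst x \<bullet> fst (F x)) * c1_step_deriv (A n x) \<ge> 0"
      proof (cases "A n x < 2")
        case 1: True
        then have "real n * (b\<^sup>2 - fst x \<bullet> fst x) < real n * m1" using nm by (simp add: A_def)
        then have "b\<^sup>2 - fst x \<bullet> fst x < m1" using n1 by simp
        from m1(2)[OF xc True this] show ?thesis using c1_step_deriv_nonneg by simp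
      qed (simp add: c1_step_deriv_eq_0)
      have t2: "(fst x \<bullet> fst (F x)) * c1_step_deriv (B n x) \<le> 0"
      proof (cases "B n x < 2")
        case 1: True
        then have "real n * (fst x \<bullet> fst x - a\<^sup>2) < real n * m2" using nm by (simp add: B_def)
        then have "fst x \<bullet> fst x - a\<^sup>2 < m2" using n1 by simp
        from m2(2)[OF xc True this] show ?thesis using c1_step_deriv_nonneg by (simp add: mult_nonpos_nonneg)
      qed (simp add: c1_step_deriv_eq_0)
      have "T n x (F x) = 2 * real n * (c1_step (A n x) * ((fst x \<bullet> fst (F x)) * c1_step_deriv (B n x)) - c1_step (B n x) * ((fst x \<bullet> fst (F x)) * c1_step_deriv (A n x)))"
        by (simp add: T_def algebra_simps)
      also have "\<dots> \<le> 0"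
        using n1 mult_nonneg_nonpos[OF c1_step_bounds(1) t2, of "A n x"] mult_nonneg_nonneg[OF c1_step_bounds(1) t1, of "B n x"]
        by (intro mult_nonneg_nonpos) auto
      finally show ?thesis by (intro mult_nonneg_nonpos bump_bounds)
    qed (use bump_outside[OF R, of "snd x"] in auto)
    have n2: "n > 0" using n1 by simp
    have "((\<lambda>x. (e n x * I x + bump R (snd x) * T n x (F x)) - e n x * I x) has_integral (0 - integral \<Omega> (\<lambda>x. e n x * I x))) \<Omega>"
      by (intro has_integral_diff key[OF n2] integrable_integral inteI)
    then have "0 - integral \<Omega> (\<lambda>x. e n x * I x) \<le> 0"
      by (rule has_integral_le[OF _ has_integral_0]) (use le0 in auto)
    then show ?thesis by simp
  qed
  have "(\<lambda>n. integral \<Omega> (\<lambda>x. e n x * I x)) \<longlonglongrightarrow> integral \<Omega> I"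
  proof (rule dominated_convergence(2))
    show "(\<lambda>x. \<bar>I x\<bar>) integrable_on \<Omega>"
      by (rule integrable_on_Omega[of _ R]) (use I0 contI in \<open>auto intro!: continuous_intros\<close>)
    show "norm (e n x * I x) \<le> \<bar>I x\<bar>" for n x
    proof -
      have "0 \<le> e n x" "e n x \<le> 1" using c1_step_bounds by (auto simp: e_def intro: mult_le_one)
      then show ?thesis by (simp add: abs_mult mult_left_le_one_le)
    qed
    show "(\<lambda>n. e n x * I x) \<longlonglongrightarrow> I x" if x: "x \<in> \<Omega>" for x
    proof -
      have "fst x \<bullet> fst x < b\<^sup>2" "a\<^sup>2 < fst x \<bullet> fst x" using x ab unfolding in_Omega dot_square_norm
        by (auto intro!: power_strict_mono)
      then have m: "min (b\<^sup>2 - fst x \<bullet> fst x) (fst x \<bullet> fst x - a\<^sup>2) > 0" (is "?m > 0") by simp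
      obtain N :: nat where N: "3 / ?m < N" using reals_Archimedean2 by blast
      have "e n x * I x = I x" if "n \<ge> N" for n
      proof -
        have "3 < ?m * N" using N m by (simp add: pos_divide_less_eq mult.commute)
        also have "\<dots> \<le> ?m * n" using m that by (intro mult_left_mono) auto
        finally have "3 < n * ?m" by (simp add: mult.commute)
        moreover have "n * ?m \<le> n * (b\<^sup>2 - fst x \<bullet> fst x)" "n * ?m \<le> n * (fst x \<bullet> fst x - a\<^sup>2)" by (intro mult_left_mono; simp)+
        ultimately have "A n x \<ge> 2" "B n x \<ge> 2" unfolding A_def B_def by linarith+
        then show ?thesis by (simp add: e_def c1_step_eq_1)
      qed
      then have "\<forall>\<^sub>F n in sequentially. e n x * I x = I x" unfolding eventually_sequentially by blast
      then show ?thesis by (rule tendsto_eventually)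
    qed
  qed (rule inteI)
  moreover have "\<forall>\<^sub>F n in sequentially. 0 \<le> integral \<Omega> (\<lambda>x. e n x * I x)"
    using nonneg unfolding eventually_sequentially by blast
  ultimately have "0 \<le> integral \<Omega> I" by (intro tendsto_lowerbound) auto
  then show ?thesis by (simp add: I_def[abs_def])
qed

end

section \<open>Traces over the orthonormal basis of a product space\<close>

lemma sum_Basis_inner_mult:
  fixes f :: "'a::euclidean_space \<Rightarrow> real"
  assumes "linear f"
  shows "(\<Sum>i\<in>Basis. f i * (v \<bullet> i)) = f v"
proof -
  have "f v = f (\<Sum>i\<in>Basis. (v \<bullet> i) *\<^sub>R i)" by (simp only: euclidean_representation)
  also have "\<dots> = (\<Sum>i\<in>Basis. f i * (v \<bullet> i))"
    by (simp only: linear_sum[OF assms] linear_cmul[OF assms]) (simp add: mult.commute)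
  finally show ?thesis by simp
qed

lemma sum_Basis_prod:
  fixes f :: "'a::euclidean_space \<times> 'b::euclidean_space \<Rightarrow> 'c::comm_monoid_add"
  shows "(\<Sum>i\<in>Basis. f i) = (\<Sum>i\<in>Basis. f (i, 0)) + (\<Sum>i\<in>Basis. f (0, i))"
proof -
  have "(\<lambda>u::'a. (u, 0::'b)) ` Basis \<inter> (\<lambda>v. (0, v)) ` Basis = {}" by auto
  then show ?thesis
    unfolding Basis_prod_def by (simp add: sum.union_disjoint sum.reindex inj_on_def)
qed

text \<open>The trace of \<open>c\<close> times the identity plus \<open>r\<close> times the
  rank-one map of \<open>y\<close>, acting on the first factor. Derivatives of radial fields in y
  have this shape, among them the perturbation field and \<chi>.\<close>

lemma sum_Basis_fst_inner:
  fixes y :: "'a::euclidean_space"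
  shows "(\<Sum>i\<in>(Basis :: ('a \<times> 'b::euclidean_space) set). ((c *\<^sub>R fst i + (r * (y \<bullet> fst i)) *\<^sub>R y, 0) :: 'a \<times> 'b) \<bullet> i)
    = c * DIM('a) + r * (y \<bullet> y)"
proof -
  have "(\<Sum>i\<in>(Basis :: ('a \<times> 'b) set). ((c *\<^sub>R fst i + (r * (y \<bullet> fst i)) *\<^sub>R y, 0) :: 'a \<times> 'b) \<bullet> i)
    = (\<Sum>i\<in>(Basis :: 'a set). c + r * ((y \<bullet> i) * (y \<bullet> i)))"
    by (simp add: sum_Basis_prod inner_add_left mult.assoc)
  also have "\<dots> = c * DIM('a) + r * (y \<bullet> y)"
    by (simp add: sum.distrib sum_distrib_left[symmetric] euclidean_inner[of y y])
  finally show ?thesis .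
qed

context annular_cylinder
begin

text \<open>The factor is built so that \<open>\<rho> * r\<close> moves linearly in \<open>t\<close>
  from the boundary radius \<open>r\<close> to the middle radius (a + b) / 2; one formula serves
  both boundary spheres.\<close>

lemma radius_between:
  assumes r: "r = a \<or> r = b" and t: "0 \<le> t" "t \<le> 1"
  defines "\<rho> \<equiv> 1 + ((a + b) / 2 / r - 1) * t"
  shows "0 < \<rho>" "0 < t \<Longrightarrow> a < \<rho> * r" "0 < t \<Longrightarrow> \<rho> * r < b"
proof -
  define m where "m = (a + b) / 2"
  have r0: "r > 0" using r ab by auto
  have eq: "\<rho> * r = (1 - t) * r + t * m" using r0 by (simp add: \<rho>_def m_def[symmetric] field_simps)
  have "0 < (1 - t) * r + t * m"
  proof (cases "t = 0")
    case False
    then have "0 \<le> (1 - t) * r" "0 < t * m" using t r0 ab by (auto simp: m_def)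
    then show ?thesis by linarith
  qed (use r0 in simp)
  then show "0 < \<rho>" using eq r0 by (metis zero_less_mult_pos2)
  assume t0: "t > 0"
  have b: "t * (b - a) \<le> b - a" "0 < t * (b - a)" using t t0 ab mult_right_mono[of t 1 "b - a"] by auto
  have "\<rho> * r = a + t * (b - a) / 2 \<or> \<rho> * r = b - t * (b - a) / 2"
    using r eq by (auto simp: m_def field_simps)
  then show "a < \<rho> * r" "\<rho> * r < b" using b ab by linarith+
qed

lemma boundary_mem_closure:
  assumes r: "norm (fst x) = r" "r = a \<or> r = b"
  shows "x \<in> closure \<Omega>" "x \<notin> \<Omega>" "x \<in> frontier \<Omega>"
proof -
  define X where "X n = ((1 + ((a + b) / 2 / r - 1) * (1 / Suc n)) *\<^sub>R fst x, snd x)" for n :: nat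
  have "X n \<in> \<Omega>" for n
    using radius_between[OF r(2), of "1 / Suc n"] r(1) by (simp add: X_def in_Omega)
  moreover have "X \<longlonglongrightarrow> x"
  proof -
    have "(\<lambda>n. 1 / real (Suc n)) \<longlonglongrightarrow> 0"
      using LIMSEQ_inverse_real_of_nat by (simp only: inverse_eq_divide)
    then have "X \<longlonglongrightarrow> ((1 + ((a + b) / 2 / r - 1) * 0) *\<^sub>R fst x, snd x)"
      unfolding X_def by (intro tendsto_intros)
    then show ?thesis by simp
  qed
  ultimately show "x \<in> closure \<Omega>" unfolding closure_sequential by blast
  moreover show "x \<notin> \<Omega>" using r by (auto simp: in_Omega)
  ultimately show "x \<in> frontier \<Omega>" by (simp add: frontier_def interior_open open_Omega)
qed

lemma flux_nonneg:
  fixes F :: "'a \<times> 'b \<Rightarrow> 'a \<times> 'b"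
  assumes contF: "continuous_on (closure \<Omega>) F"
    and der: "\<And>x. x \<in> \<Omega> \<Longrightarrow> (F has_derivative F' x) (at x)"
    and cont: "\<And>i. i \<in> Basis \<Longrightarrow> continuous_on \<Omega> (\<lambda>x. F' x i \<bullet> i)"
    and div: "\<And>x. x \<in> \<Omega> \<Longrightarrow> (\<Sum>i\<in>Basis. F' x i \<bullet> i) = D x"
    and contD: "continuous_on (closure \<Omega>) D"
    and out: "\<And>x. x \<in> closure \<Omega> \<Longrightarrow> norm (fst x) = b \<Longrightarrow> fst x \<bullet> fst (F x) \<ge> 0"
    and inn: "\<And>x. x \<in> closure \<Omega> \<Longrightarrow> norm (fst x) = a \<Longrightarrow> fst x \<bullet> fst (F x) \<le> 0"
    and R: "R > 0"
  shows "0 \<le> integral \<Omega> (\<lambda>x. bump R (snd x) * D x + bump_deriv R (snd x) (snd (F x)))"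
proof -
  \<comment> \<open>\<open>E\<close> points strictly outwards on both boundary components, so \<open>F + d E\<close> satisfies the strict version.\<close>
  define c where "c = (a\<^sup>2 + b\<^sup>2) / 2"
  define E :: "'a \<times> 'b \<Rightarrow> 'a \<times> 'b" where "E x = ((fst x \<bullet> fst x - c) *\<^sub>R fst x, 0)" for x
  define E' :: "'a \<times> 'b \<Rightarrow> 'a \<times> 'b \<Rightarrow> 'a \<times> 'b"
    where "E' x v = ((fst x \<bullet> fst x - c) *\<^sub>R fst v + (2 * (fst x \<bullet> fst v)) *\<^sub>R fst x, 0)" for x v
  define DE where "DE x = (fst x \<bullet> fst x - c) * DIM('a) + 2 * (fst x \<bullet> fst x)" for x :: "'a \<times> 'b"
  define I where "I x = bump R (snd x) * D x + bump_deriv R (snd x) (snd (F x))" for x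
  define J where "J x = bump R (snd x) * DE x" for x :: "'a \<times> 'b"
  have a2b2: "a\<^sup>2 < b\<^sup>2" using ab by (intro power_strict_mono) auto
  have dE: "(E has_derivative E' x) (at x)" for x
    unfolding E_def E'_def by (auto intro!: derivative_eq_intros simp: inner_commute)
  have contDE: "continuous_on S DE" and contE: "continuous_on S E" for S
    unfolding DE_def E_def by (intro continuous_intros)+
  have contI: "continuous_on (closure \<Omega>) I" unfolding I_def by (intro continuous_intros contF contD)
  have contJ: "continuous_on (closure \<Omega>) J" unfolding J_def by (intro continuous_intros contDE)
  have intI: "I integrable_on \<Omega>" and intJ: "J integrable_on \<Omega>"
    by (rule integrable_on_Omega[of _ R], use contI contJ in \<open>auto simp: I_def J_def bump_outside[OF R]\<close>)+
  have pert: "0 \<le> integral \<Omega> I + d * integral \<Omega> J" if d: "d > 0" for d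
  proof -
    have "0 \<le> integral \<Omega> (\<lambda>x. bump R (snd x) * (D x + d * DE x) + bump_deriv R (snd x) (snd (F x + d *\<^sub>R E x)))"
    proof (rule flux_nonneg_strict[where F'="\<lambda>x v. F' x v + d *\<^sub>R E' x v"])
      show "continuous_on (closure \<Omega>) (\<lambda>x. F x + d *\<^sub>R E x)" by (intro continuous_intros contF contE)
      show "((\<lambda>x. F x + d *\<^sub>R E x) has_derivative (\<lambda>v. F' x v + d *\<^sub>R E' x v)) (at x)" if "x \<in> \<Omega>" for x
        by (intro has_derivative_add has_derivative_scaleR_right der that dE)
      show "continuous_on \<Omega> (\<lambda>x. (F' x i + d *\<^sub>R E' x i) \<bullet> i)" if i: "i \<in> Basis" for i
        unfolding inner_add_left E'_def by (intro continuous_intros cont[OF i])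
      show "(\<Sum>i\<in>Basis. (F' x i + d *\<^sub>R E' x i) \<bullet> i) = D x + d * DE x" if x: "x \<in> \<Omega>" for x
      proof -
        have "(\<Sum>i\<in>Basis. E' x i \<bullet> i) = DE x" unfolding E'_def sum_Basis_fst_inner DE_def ..
        then show ?thesis using div[OF x]
          by (simp only: inner_add_left inner_scaleR_left sum.distrib sum_distrib_left[symmetric])
      qed
      show "continuous_on (closure \<Omega>) (\<lambda>x. D x + d * DE x)" by (intro continuous_intros contD contDE)
      show "fst x \<bullet> fst (F x + d *\<^sub>R E x) > 0" if "x \<in> closure \<Omega>" "norm (fst x) = b" for x
      proof -
        have "fst x \<bullet> fst x = b\<^sup>2" using that by (simp add: dot_square_norm)
        then have "fst x \<bullet> fst (d *\<^sub>R E x) > 0" using d ab a2b2 by (simp add: E_def c_def)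
        then show ?thesis using out[OF that] by (simp add: inner_add_right)
      qed
      show "fst x \<bullet> fst (F x + d *\<^sub>R E x) < 0" if "x \<in> closure \<Omega>" "norm (fst x) = a" for x
      proof -
        have "fst x \<bullet> fst x = a\<^sup>2" using that by (simp add: dot_square_norm)
        then have "fst x \<bullet> fst (d *\<^sub>R E x) < 0" using d ab a2b2 by (simp add: E_def c_def mult_less_0_iff)
        then show ?thesis using inn[OF that] by (simp add: inner_add_right)
      qed
    qed (rule R)
    \<comment> \<open>As \<open>E\<close> has no z-component, the cutoff gradient sees only
      \<open>F\<close>, and the whole expression is affine in \<open>d\<close>.\<close>
    also have "(\<lambda>x. bump R (snd x) * (D x + d * DE x) + bump_deriv R (snd x) (snd (F x + d *\<^sub>R E x))) = (\<lambda>x. I x + d * J x)"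
      by (auto simp: I_def J_def E_def algebra_simps)
    also have "integral \<Omega> (\<lambda>x. I x + d * J x) = integral \<Omega> I + d * integral \<Omega> J"
      by (intro integral_unique has_integral_add has_integral_mult_right integrable_integral intI intJ)
    finally show ?thesis .
  qed
  have "((\<lambda>d. integral \<Omega> I + d * integral \<Omega> J) \<longlongrightarrow> integral \<Omega> I + 0 * integral \<Omega> J) (at_right 0)"
    by (intro tendsto_intros)
  then have "0 \<le> integral \<Omega> I + 0 * integral \<Omega> J"
    by (rule tendsto_lowerbound) (use pert in \<open>auto intro: eventually_mono[OF eventually_at_right_less]\<close>)
  then show ?thesis by (simp add: I_def[abs_def])
qed

section \<open>Normality of the gradient on the boundary\<close>

text \<open>On the boundary \<open>G\<close> is only a continuous limit of gradients, so it cannot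
  be paired directly with curves in the boundary. If the pairing were positive, \<open>u\<close>
  would grow by a fixed amount along nearby curves inside \<Omega>, and in the limit along a
  boundary curve, where it is 0. The condition \<open>norm w = r\<close> lets the curve be a
  rotation of y towards \<open>w\<close>, which keeps the radius.\<close>

lemma tangential_derivative_nonpos:
  fixes u :: "'a \<times> 'b \<Rightarrow> real"
  assumes contu: "continuous_on (closure \<Omega>) u" and u0: "\<And>x. x \<in> frontier \<Omega> \<Longrightarrow> u x = 0"
    and contG: "continuous_on (closure \<Omega>) G"
    and du: "\<And>x. x \<in> \<Omega> \<Longrightarrow> (u has_derivative (\<lambda>v. G x \<bullet> v)) (at x)"
    and r: "norm (fst x) = r" "r = a \<or> r = b"
    and w: "w \<bullet> fst x = 0" "norm w = r"
  shows "G x \<bullet> (w, v) \<le> 0"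
proof (rule ccontr)
  define c where "c = G x \<bullet> (w, v)"
  assume "\<not> G x \<bullet> (w, v) \<le> 0"
  then have c: "c > 0" by (simp add: c_def)
  \<comment> \<open>\<open>\<gamma> 0\<close> is a curve in the boundary with velocity \<open>(w, v)\<close> at \<open>x\<close>; the curves \<open>\<gamma> s\<close> push it into \<open>\<Omega>\<close>.\<close>
  define \<rho> where "\<rho> s = 1 + ((a + b) / 2 / r - 1) * s" for s
  define \<gamma> where "\<gamma> s t = (\<rho> s *\<^sub>R (cos t *\<^sub>R fst x + sin t *\<^sub>R w), snd x + t *\<^sub>R v)" for s t
  define \<gamma>' where "\<gamma>' s t = (\<rho> s *\<^sub>R (- sin t *\<^sub>R fst x + cos t *\<^sub>R w), v)" for s t
  have r0: "r > 0" using r ab by auto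
  have rho: "0 < \<rho> s" "s > 0 \<Longrightarrow> a < \<rho> s * r \<and> \<rho> s * r < b" if s: "0 \<le> s" "s \<le> 1" for s
    using radius_between[OF r(2) s] by (auto simp: \<rho>_def)
  have norm_\<gamma>: "norm (fst (\<gamma> s t)) = \<rho> s * r" if s: "0 \<le> s" "s \<le> 1" for s t
  proof -
    have "(norm (cos t *\<^sub>R fst x + sin t *\<^sub>R w))\<^sup>2 = (cos t)\<^sup>2 * r\<^sup>2 + (sin t)\<^sup>2 * r\<^sup>2"
    proof -
      have "w \<bullet> w = r\<^sup>2" "fst x \<bullet> fst x = r\<^sup>2" using w r(1) by (simp_all add: dot_square_norm)
      then show ?thesis using w(1)
        by (simp add: power2_norm_eq_inner inner_add_left inner_add_right inner_commute[of "fst x" w])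
          (simp add: power2_eq_square)
    qed
    also have "\<dots> = ((cos t)\<^sup>2 + (sin t)\<^sup>2) * r\<^sup>2" by (simp add: algebra_simps del: sin_cos_squared_add sin_cos_squared_add2)
    finally have "norm (cos t *\<^sub>R fst x + sin t *\<^sub>R w) = r" using r0 by simp
    then show ?thesis using rho(1)[OF s] by (simp add: \<gamma>_def)
  qed
  have in_O: "\<gamma> s t \<in> \<Omega>" if "0 < s" "s \<le> 1" for s t
    using rho(2)[of s] norm_\<gamma>[of s t] that by (simp add: in_Omega)
  have bd: "norm (fst (\<gamma> 0 t)) = r" for t using norm_\<gamma>[of 0 t] by (simp add: \<rho>_def)
  have in_cl: "\<gamma> s t \<in> closure \<Omega>" if "0 \<le> s" "s \<le> 1" for s t
    using in_O[of s t] that boundary_mem_closure(1)[OF bd r(2)] closure_subset by (cases "s = 0") auto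
  have u_bd: "u (\<gamma> 0 t) = 0" for t using u0 boundary_mem_closure(3)[OF bd r(2)] by blast
  have cont_\<gamma>: "continuous_on S (\<lambda>p. \<gamma> (fst p) (snd p))" and cont_\<gamma>': "continuous_on S (\<lambda>p. \<gamma>' (fst p) (snd p))" for S
    unfolding \<gamma>_def \<gamma>'_def \<rho>_def by (intro continuous_intros)+
  let ?k = "\<lambda>p. G (\<gamma> (fst p) (snd p)) \<bullet> \<gamma>' (fst p) (snd p)"
  have "continuous_on ({0..1} \<times> UNIV) (\<lambda>p. G (\<gamma> (fst p) (snd p)))"
    by (rule continuous_on_compose2[OF contG cont_\<gamma>]) (use in_cl in auto)
  then have "continuous_on ({0..1} \<times> UNIV) ?k" by (intro continuous_intros cont_\<gamma>')
  moreover have "(0, 0) \<in> {0..1::real} \<times> (UNIV::real set)" by simp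
  moreover have "?k (0, 0) = c" by (simp add: c_def \<gamma>_def \<gamma>'_def \<rho>_def)
  ultimately obtain d where d: "d > 0"
    and near: "\<And>p. p \<in> {0..1} \<times> UNIV \<Longrightarrow> dist p (0, 0) < d \<Longrightarrow> \<bar>?k p - c\<bar> < c / 2"
    using c unfolding continuous_on_iff dist_real_def by (metis half_gt_zero)
  define T where "T = d / 2"
  have T: "T > 0" using d by (simp add: T_def)
  have lower: "u (\<gamma> s T) - u (\<gamma> s 0) \<ge> T * (c / 2)" if s: "0 < s" "s \<le> 1" "s < d / 2" for s
  proof -
    have "\<exists>t. 0 < t \<and> t < T \<and> u (\<gamma> s T) - u (\<gamma> s 0) = (T - 0) * (G (\<gamma> s t) \<bullet> \<gamma>' s t)"
    proof (rule MVT2[OF T])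
      fix t
      have "(\<gamma> s has_derivative (\<lambda>h. h *\<^sub>R \<gamma>' s t)) (at t)"
        unfolding \<gamma>_def \<gamma>'_def by (auto intro!: derivative_eq_intros simp: algebra_simps)
      from has_derivative_compose[OF this du[OF in_O[OF s(1,2)]]]
      show "((\<lambda>t. u (\<gamma> s t)) has_real_derivative G (\<gamma> s t) \<bullet> \<gamma>' s t) (at t)"
        by (auto simp: has_field_derivative_def mult.commute elim!: has_derivative_eq_rhs)
    qed
    then obtain t where t: "0 < t" "t < T" "u (\<gamma> s T) - u (\<gamma> s 0) = T * (G (\<gamma> s t) \<bullet> \<gamma>' s t)" by auto
    have "dist (s, t) (0, 0) \<le> s + t" using s t norm_Pair_le[of s t] by (simp add: dist_norm)
    also have "\<dots> < d" using s t by (simp add: T_def)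
    finally have "\<bar>G (\<gamma> s t) \<bullet> \<gamma>' s t - c\<bar> < c / 2" using near[of "(s, t)"] s by simp
    then have "G (\<gamma> s t) \<bullet> \<gamma>' s t \<ge> c / 2" by linarith
    then show ?thesis unfolding t(3) using T by (intro mult_left_mono) auto
  qed
  have lim: "((\<lambda>s. u (\<gamma> s t)) \<longlongrightarrow> u (\<gamma> 0 t)) (at_right 0)" for t
  proof -
    have "continuous_on {0..1} (\<lambda>s. u (\<gamma> s t))"
      by (rule continuous_on_compose2[OF contu])
        (use in_cl in \<open>auto simp: \<gamma>_def \<rho>_def intro!: continuous_intros\<close>)
    then have "((\<lambda>s. u (\<gamma> s t)) \<longlongrightarrow> u (\<gamma> 0 t)) (at 0 within {0..1})"
      by (auto simp: continuous_on_def)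
    then show ?thesis by (simp add: at_within_Icc_at_right)
  qed
  have "((\<lambda>s. u (\<gamma> s T) - u (\<gamma> s 0)) \<longlongrightarrow> u (\<gamma> 0 T) - u (\<gamma> 0 0)) (at_right 0)"
    by (intro tendsto_diff lim)
  then have "T * (c / 2) \<le> u (\<gamma> 0 T) - u (\<gamma> 0 0)"
    by (rule tendsto_lowerbound)
      (use d lower in \<open>auto simp: eventually_at_right intro!: exI[of _ "min 1 (d / 2)"]\<close>)
  moreover have "0 < T * (c / 2)" using T c by simp
  ultimately show False using u_bd by simp
qed

text \<open>Applying the one-sided bound to a tangent vector and to its negative gives equality.
  Rescaling removes the condition on the length of \<open>w\<close>, leaving \<open>w\<close>
  nonzero and orthogonal to y and \<open>v\<close> arbitrary.\<close>

lemma boundary_gradient: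
  fixes u :: "'a \<times> 'b \<Rightarrow> real"
  assumes contu: "continuous_on (closure \<Omega>) u" and u0: "\<And>x. x \<in> frontier \<Omega> \<Longrightarrow> u x = 0"
    and contG: "continuous_on (closure \<Omega>) G"
    and du: "\<And>x. x \<in> \<Omega> \<Longrightarrow> (u has_derivative (\<lambda>v. G x \<bullet> v)) (at x)"
    and dim: "DIM('a) \<ge> 2"
    and r: "norm (fst x) = r" "r = a \<or> r = b"
  shows "\<exists>l. G x = (l *\<^sub>R fst x, 0)"
proof -
  have r0: "r > 0" using r ab by auto
  have tan: "G x \<bullet> (w, v) = 0" if w: "w \<bullet> fst x = 0" "norm w = r" for w v
  proof -
    have "G x \<bullet> (w, v) \<le> 0" using tangential_derivative_nonpos[OF contu u0 contG du r w] by blast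
    moreover have "G x \<bullet> (- w, - v) \<le> 0"
      using tangential_derivative_nonpos[OF contu u0 contG du r, of "- w"] w by simp
    moreover have "G x \<bullet> (- w, - v) = - (G x \<bullet> (w, v))" by (simp add: inner_Pair[of "fst (G x)" "snd (G x)", simplified])
    ultimately show ?thesis by simp
  qed
  have tan': "fst (G x) \<bullet> w + snd (G x) \<bullet> v = 0" if "w \<bullet> fst x = 0" "w \<noteq> 0" for w v
  proof -
    have "G x \<bullet> ((r / norm w) *\<^sub>R w, (r / norm w) *\<^sub>R v) = 0"
      using that r0 by (intro tan) auto
    then have "(r / norm w) * (fst (G x) \<bullet> w + snd (G x) \<bullet> v) = 0"
      by (cases "G x") (simp add: algebra_simps)
    then show ?thesis using that r0 by simp
  qed
  \<comment> \<open>The tangential identity is available only for nonzero \<open>w\<close>, so a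
    fixed \<open>w0\<close> accompanies \<open>v\<close>; comparing \<open>v = snd (G x)\<close>
    with \<open>v = 0\<close> cancels its contribution.\<close>
  obtain w0 :: 'a where w0: "w0 \<noteq> 0" "w0 \<bullet> fst x = 0"
    using orthogonal_to_vector_exists[OF dim, of "fst x"] by (auto simp: orthogonal_def inner_commute)
  have "snd (G x) \<bullet> snd (G x) = 0"
    using tan'[OF w0(2,1), of "snd (G x)"] tan'[OF w0(2,1), of 0] by simp
  then have s0: "snd (G x) = 0" by simp
  define l where "l = (fst (G x) \<bullet> fst x) / (fst x \<bullet> fst x)"
  define w where "w = fst (G x) - l *\<^sub>R fst x"
  have "fst x \<noteq> 0" using r r0 by auto
  then have wo: "w \<bullet> fst x = 0" by (simp add: w_def l_def inner_diff_left)
  have "w = 0"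
  proof (rule ccontr)
    assume "w \<noteq> 0"
    then have "fst (G x) \<bullet> w = 0" using tan'[OF wo, of 0] by simp
    then have "w \<bullet> w = 0" using wo by (simp add: w_def inner_diff_left inner_commute inner_diff_right)
    then show False using \<open>w \<noteq> 0\<close> by simp
  qed
  then have "G x = (l *\<^sub>R fst x, 0)" using s0 by (simp add: w_def prod_eq_iff)
  then show ?thesis ..
qed

end

lemma norm_fst_le_norm: "norm (fst x) \<le> norm x" and norm_snd_le_norm: "norm (snd x) \<le> norm x"
  using norm_fst_le[of "fst x" "snd x"] norm_snd_le[of "snd x" "fst x"] by simp_all

context annular_cylinder
begin

text \<open>Poincare's inequality on the slab: the field \<open>- u\<^sup>2 (y, 0)\<close> has no \<open>z\<close>-component, so the cutoff in \<open>z\<close> produces no error term.\<close>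

lemma square_integrable:
  fixes u :: "'a \<times> 'b \<Rightarrow> real"
  assumes contu: "continuous_on (closure \<Omega>) u" and u0: "\<And>x. x \<in> frontier \<Omega> \<Longrightarrow> u x = 0"
    and contG: "continuous_on (closure \<Omega>) G"
    and du: "\<And>x. x \<in> \<Omega> \<Longrightarrow> (u has_derivative (\<lambda>v. G x \<bullet> v)) (at x)"
    and dim: "DIM('a) \<ge> 2"
    and intG: "(\<lambda>x. (norm (G x))\<^sup>2) integrable_on \<Omega>"
  shows "(\<lambda>x. (u x)\<^sup>2) integrable_on \<Omega>"
proof -
  define F :: "'a \<times> 'b \<Rightarrow> 'a \<times> 'b" where "F x = ((- (u x)\<^sup>2) *\<^sub>R fst x, 0)" for x
  define F' :: "'a \<times> 'b \<Rightarrow> 'a \<times> 'b \<Rightarrow> 'a \<times> 'b"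
    where "F' x v = ((- (u x)\<^sup>2) *\<^sub>R fst v + (- (2 * u x * (G x \<bullet> v))) *\<^sub>R fst x, 0)" for x v
  define D where "D x = - (u x)\<^sup>2 * DIM('a) - 2 * u x * (fst (G x) \<bullet> fst x)" for x
  have contu': "continuous_on \<Omega> u" and contG': "continuous_on \<Omega> G"
    using contu contG closure_subset continuous_on_subset by blast+
  have flux: "0 \<le> integral \<Omega> (\<lambda>x. bump R (snd x) * D x + bump_deriv R (snd x) (snd (F x)))" if R: "R > 0" for R
  proof (rule flux_nonneg[where F'=F'])
    show "continuous_on (closure \<Omega>) F" unfolding F_def by (intro continuous_intros contu)
    show "continuous_on (closure \<Omega>) D" unfolding D_def by (intro continuous_intros contu contG)
    show "continuous_on \<Omega> (\<lambda>x. F' x i \<bullet> i)" for i unfolding F'_def by (intro continuous_intros contu' contG')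
    show "(F has_derivative F' x) (at x)" if "x \<in> \<Omega>" for x
      unfolding F_def F'_def using du[OF that] by (auto intro!: derivative_eq_intros)
    show "(\<Sum>i\<in>Basis. F' x i \<bullet> i) = D x" for x
      by (simp add: F'_def D_def sum_Basis_prod inner_prod_def inner_diff_left sum_subtractf sum_negf
          euclidean_inner[of "fst (G x)" "fst x"] sum_distrib_left algebra_simps)
    show "fst x \<bullet> fst (F x) \<ge> 0" if "norm (fst x) = b" for x
      using u0[OF boundary_mem_closure(3)[OF that]] by (simp add: F_def)
    show "fst x \<bullet> fst (F x) \<le> 0" if "norm (fst x) = a" for x
      using u0[OF boundary_mem_closure(3)[OF that]] by (simp add: F_def)
  qed (rule R)
  \<comment> \<open>With d = \<open>DIM('a)\<close>, g = \<open>fst (G x)\<close> and y =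
    \<open>fst x\<close>, \<open>- D x\<close> is \<open>d u\<^sup>2 + 2 u (g \<bullet> y)\<close>.
    Since d \<ge> 2 this is at least \<open>u\<^sup>2 + (u + g \<bullet> y)\<^sup>2 - (g \<bullet>
    y)\<^sup>2\<close>, and the last square is at most
    \<open>b\<^sup>2 (norm (G x))\<^sup>2\<close>.\<close>
  have D_le: "(u x)\<^sup>2 \<le> b\<^sup>2 * (norm (G x))\<^sup>2 - D x" if x: "x \<in> \<Omega>" for x
  proof -
    have "norm (fst x) \<le> b" using x by (simp add: in_Omega)
    then have "\<bar>fst (G x) \<bullet> fst x\<bar> \<le> norm (G x) * b"
      by (intro order_trans[OF Cauchy_Schwarz_ineq2] mult_mono norm_fst_le_norm) auto
    then have "(fst (G x) \<bullet> fst x)\<^sup>2 \<le> (norm (G x) * b)\<^sup>2"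
      using ab by (intro abs_le_square_iff[THEN iffD1]) auto
    moreover have "0 \<le> (u x + fst (G x) \<bullet> fst x)\<^sup>2" by simp
    moreover have "2 * (u x)\<^sup>2 \<le> DIM('a) * (u x)\<^sup>2" using dim by (intro mult_right_mono) auto
    ultimately show ?thesis unfolding D_def power2_sum power_mult_distrib by (simp add: algebra_simps)
  qed
  \<comment> \<open>Integrability of the limit is the goal, so the passage is by monotone
    convergence: \<open>f n\<close> increases to \<open>u\<^sup>2\<close> and its integrals are
    bounded uniformly in \<open>n\<close>.\<close>
  define f where "f n x = bump (real (Suc n)) (snd x) * (u x)\<^sup>2" for n x
  have intf: "f n integrable_on \<Omega>" for n
    by (rule integrable_on_Omega[of _ "Suc n"])
      (auto simp: f_def bump_outside intro!: continuous_intros contu)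
  have f_le: "integral \<Omega> (f n) \<le> b\<^sup>2 * integral \<Omega> (\<lambda>x. (norm (G x))\<^sup>2)" for n
  proof -
    let ?R = "real (Suc n)"
    have iD: "(\<lambda>x. bump ?R (snd x) * D x) integrable_on \<Omega>"
      unfolding D_def
      by (rule integrable_on_Omega[of _ ?R]) (auto simp: bump_outside intro!: continuous_intros contu contG)
    have "integral \<Omega> (f n) \<le> integral \<Omega> (\<lambda>x. b\<^sup>2 * (norm (G x))\<^sup>2 - bump ?R (snd x) * D x)"
    proof (rule integral_le)
      show "(\<lambda>x. b\<^sup>2 * (norm (G x))\<^sup>2 - bump ?R (snd x) * D x) integrable_on \<Omega>"
        by (intro integrable_diff integrable_on_mult_right intG iD)
      show "f n x \<le> b\<^sup>2 * (norm (G x))\<^sup>2 - bump ?R (snd x) * D x" if "x \<in> \<Omega>" for x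
      proof -
        have "f n x \<le> bump ?R (snd x) * (b\<^sup>2 * (norm (G x))\<^sup>2 - D x)"
          unfolding f_def by (intro mult_left_mono D_le that bump_bounds)
        also have "\<dots> = bump ?R (snd x) * (b\<^sup>2 * (norm (G x))\<^sup>2) - bump ?R (snd x) * D x"
          by (simp add: algebra_simps)
        also have "\<dots> \<le> b\<^sup>2 * (norm (G x))\<^sup>2 - bump ?R (snd x) * D x"
          by (intro diff_mono mult_left_le_one_le bump_bounds) auto
        finally show ?thesis .
      qed
    qed (rule intf)
    also have "\<dots> = b\<^sup>2 * integral \<Omega> (\<lambda>x. (norm (G x))\<^sup>2) - integral \<Omega> (\<lambda>x. bump ?R (snd x) * D x)"
      by (intro integral_unique has_integral_diff has_integral_mult_right integrable_integral intG iD)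
    also have "\<dots> \<le> b\<^sup>2 * integral \<Omega> (\<lambda>x. (norm (G x))\<^sup>2)"
      using flux[of ?R] by (simp add: F_def bump_deriv_def)
    finally show ?thesis .
  qed
  have "bounded (range (\<lambda>n. integral \<Omega> (f n)))"
  proof -
    have "0 \<le> integral \<Omega> (f n)" for n
      by (rule integral_nonneg[OF intf]) (simp add: f_def bump_bounds)
    then show ?thesis using f_le unfolding bounded_iff by (metis (no_types, lifting) abs_of_nonneg rangeE real_norm_def)
  qed
  moreover have "f n x \<le> f (Suc n) x" for n x
    unfolding f_def by (intro mult_right_mono bump_mono) auto
  moreover have "(\<lambda>n. f n x) \<longlonglongrightarrow> (u x)\<^sup>2" for x
  proof -
    have "(\<lambda>n. inverse (real (Suc n))) \<longlonglongrightarrow> 0" by (rule LIMSEQ_inverse_real_of_nat)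
    then have "(\<lambda>n. (max 0 (1 - (snd x \<bullet> snd x) * (inverse (real (Suc n)))\<^sup>2))\<^sup>2 * (u x)\<^sup>2)
        \<longlonglongrightarrow> (max 0 (1 - (snd x \<bullet> snd x) * 0\<^sup>2))\<^sup>2 * (u x)\<^sup>2"
      by (intro tendsto_intros)
    then show ?thesis by (simp add: f_def bump_def divide_inverse power_inverse)
  qed
  ultimately show ?thesis using monotone_convergence_increasing[of f \<Omega> "\<lambda>x. (u x)\<^sup>2", OF intf] by blast
qed

end

section \<open>The Pohozaev identity\<close>

text \<open>The problem in coordinate-free form: \<open>G\<close> is the gradient inside \<Omega>
  together with its continuous extension to the closure, and \<open>H\<close> is the Hessian as a
  linear map, available only inside.\<close>

locale supercritical_solution = annular_cylinder a b \<Omega>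
  for a b and \<Omega> :: "('a::euclidean_space \<times> 'b::euclidean_space) set" +
  fixes u :: "'a \<times> 'b \<Rightarrow> real" and G :: "'a \<times> 'b \<Rightarrow> 'a \<times> 'b" and H and p :: real
  assumes dims: "DIM('a) \<ge> 2" "DIM('b) \<ge> 2"
    and p_ge: "p \<ge> 2 * real (DIM('b) + 1) / (real (DIM('b) + 1) - 2)"
    and contu: "continuous_on (closure \<Omega>) u" and contG: "continuous_on (closure \<Omega>) G"
    and du: "\<And>x. x \<in> \<Omega> \<Longrightarrow> (u has_derivative (\<lambda>v. G x \<bullet> v)) (at x)"
    and dG: "\<And>x. x \<in> \<Omega> \<Longrightarrow> (G has_derivative H x) (at x)"
    and contH: "\<And>v. continuous_on \<Omega> (\<lambda>x. H x v)"
    and eqn: "\<And>x. x \<in> \<Omega> \<Longrightarrow> (\<Sum>i\<in>Basis. H x i \<bullet> i) = - (\<bar>u x\<bar> powr (p - 2) * u x)"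
    and u0: "\<And>x. x \<in> frontier \<Omega> \<Longrightarrow> u x = 0"
    and intG: "(\<lambda>x. (norm (G x))\<^sup>2) integrable_on \<Omega>"
    and intu: "(\<lambda>x. \<bar>u x\<bar> powr p) integrable_on \<Omega>"
begin

text \<open>The first component of \<open>chi\<close> is the radial field with divergence 1 whose flux vanishes on \<open>|y| = a\<close>. Its
  derivative has the eigenvalue \<open>(1 - theta) / d\<close> in tangential and \<open>(1 - theta) / d + theta\<close> in radial directions,
  \<open>d\<close> being the dimension of the \<open>y\<close>-space; both are less than 1 in \<open>\<Omega>\<close>.\<close>

definition theta :: "'a \<times> 'b \<Rightarrow> real" where
  "theta x = (a / norm (fst x)) ^ DIM('a)"

definition chi :: "'a \<times> 'b \<Rightarrow> 'a \<times> 'b" where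
  "chi x = (((1 - theta x) / DIM('a)) *\<^sub>R fst x, snd x)"

definition chi_deriv :: "'a \<times> 'b \<Rightarrow> 'a \<times> 'b \<Rightarrow> 'a \<times> 'b" where
  "chi_deriv x v = (((1 - theta x) / DIM('a)) *\<^sub>R fst v +
     (theta x / (norm (fst x))\<^sup>2 * (fst x \<bullet> fst v)) *\<^sub>R fst x, snd v)"

text \<open>The coefficient of \<open>u \<nabla>u\<close> that cancels \<open>|u|\<^sup>p\<close> in the divergence of the Pohozaev field.\<close>

definition kappa :: real where
  "kappa = real (DIM('b) + 1) / p"

definition pohozaev :: "'a \<times> 'b \<Rightarrow> 'a \<times> 'b" where
  "pohozaev x = (chi x \<bullet> G x) *\<^sub>R G x + (\<bar>u x\<bar> powr p / p - (G x \<bullet> G x) / 2) *\<^sub>R chi x + (kappa * u x) *\<^sub>R G x"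

definition pohozaev_deriv :: "'a \<times> 'b \<Rightarrow> 'a \<times> 'b \<Rightarrow> 'a \<times> 'b" where
  "pohozaev_deriv x v = (chi x \<bullet> G x) *\<^sub>R H x v + (chi x \<bullet> H x v + chi_deriv x v \<bullet> G x) *\<^sub>R G x
     + ((\<bar>u x\<bar> powr p / p - (G x \<bullet> G x) / 2) *\<^sub>R chi_deriv x v
     + (\<bar>u x\<bar> powr (p - 2) * u x * (G x \<bullet> v) - G x \<bullet> H x v) *\<^sub>R chi x)
     + ((kappa * u x) *\<^sub>R H x v + (kappa * (G x \<bullet> v)) *\<^sub>R G x)"

definition pohozaev_div :: "'a \<times> 'b \<Rightarrow> real" where
  "pohozaev_div x = chi_deriv x (G x) \<bullet> G x + (kappa - real (DIM('b) + 1) / 2) * (G x \<bullet> G x)"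

lemma p_gt_2: "p > 2"
proof -
  have "2 < 2 * real (DIM('b) + 1) / (real (DIM('b) + 1) - 2)" using dims by (simp add: field_simps)
  then show ?thesis using p_ge by linarith
qed

lemma kappa_nonneg: "kappa \<ge> 0"
  using p_gt_2 by (simp add: kappa_def)

text \<open>The range of \<open>p\<close> enters through this bound, with equality exactly at the
  critical exponent. The value -1 is what the sign of \<open>pohozaev_div\<close> asks for:
  \<open>chi_deriv\<close> is the identity on the z-part, so the z-gradient occurs there with
  coefficient at most 1 - 1 = 0.\<close>

lemma kappa_le: "kappa - real (DIM('b) + 1) / 2 \<le> -1"
proof -
  have k: "real (DIM('b) + 1) - 2 > 0" using dims by simp
  then have "2 * real (DIM('b) + 1) \<le> p * (real (DIM('b) + 1) - 2)"
    using p_ge by (simp add: pos_divide_le_eq)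
  then have "kappa \<le> (real (DIM('b) + 1) - 2) / 2"
    using p_gt_2 unfolding kappa_def by (simp add: divide_le_eq mult.commute)
  moreover have "kappa - K / 2 \<le> -1" if "kappa \<le> (K - 2) / 2" for K
    using that by (simp add: field_simps)
  ultimately show ?thesis by blast
qed

lemma norm_fst_pos: "x \<in> closure \<Omega> \<Longrightarrow> norm (fst x) > 0"
  by (rule less_le_trans[OF ab(1)]) (use closure_Omega_le in blast)

lemma theta_bounds:
  assumes "x \<in> closure \<Omega>"
  shows "0 \<le> theta x" "theta x \<le> 1"
proof -
  have "0 \<le> a / norm (fst x)" "a / norm (fst x) \<le> 1"
    using closure_Omega_le[OF assms] ab norm_fst_pos[OF assms] by (auto simp: divide_le_eq)
  then show "0 \<le> theta x" "theta x \<le> 1" unfolding theta_def by (auto intro: power_le_one)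
qed

lemma theta_less_1: "x \<in> \<Omega> \<Longrightarrow> theta x < 1"
proof -
  assume "x \<in> \<Omega>"
  then have "0 \<le> a / norm (fst x)" "a / norm (fst x) < 1" using ab by (auto simp: in_Omega divide_less_eq)
  then show ?thesis unfolding theta_def using dims by (intro power_less_one_iff[THEN iffD2]) auto
qed

lemma chi_has_derivative:
  assumes "x \<in> \<Omega>"
  shows "(chi has_derivative chi_deriv x) (at x)"
proof -
  have n0: "norm (fst x) > 0" using assms closure_subset norm_fst_pos by blast
  have dn: "((\<lambda>x. norm (fst x)) has_derivative (\<lambda>v. fst v \<bullet> sgn (fst x))) (at x)"
    by (rule has_derivative_compose[OF has_derivative_fst[OF has_derivative_ident] has_derivative_norm]) (use n0 in auto)
  have dt: "(theta has_derivative (\<lambda>v. - (DIM('a) * theta x / (norm (fst x))\<^sup>2 * (fst x \<bullet> fst v)))) (at x)"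
  proof -
    have pow: "theta x = a / norm (fst x) * (a / norm (fst x)) ^ (DIM('a) - 1)"
      unfolding theta_def by (metis DIM_positive Suc_pred' power_Suc)
    have "((\<lambda>x. a / norm (fst x)) has_derivative (\<lambda>v. - (a * (fst v \<bullet> sgn (fst x)) / (norm (fst x))\<^sup>2))) (at x)"
      using n0 by (auto intro!: derivative_eq_intros dn simp: divide_inverse power2_eq_square)
    note has_derivative_power[OF this, of "DIM('a)"]
    then show ?thesis
      unfolding theta_def[abs_def, symmetric]
      by (rule has_derivative_eq_rhs) (simp add: fun_eq_iff pow sgn_div_norm inner_commute divide_inverse power2_eq_square)
  qed
  show ?thesis
    unfolding chi_def[abs_def] chi_deriv_def
    by (auto intro!: derivative_eq_intros dt simp: field_simps)
qed

lemma chi_deriv_linear: "linear (chi_deriv x)"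
  by (rule linearI) (auto simp: chi_deriv_def algebra_simps inner_add_right add_divide_distrib)

text \<open>With d = \<open>DIM('a)\<close>, the field \<open>y / d\<close> has divergence 1, and
  the correction is a multiple of \<open>y / |y|^d\<close>, which is divergence free. In the trace
  this shows as the cancellation of the two occurrences of \<open>theta\<close>; the z-part adds
  \<open>DIM('b)\<close>.\<close>

lemma chi_div:
  assumes "x \<in> \<Omega>"
  shows "(\<Sum>i\<in>Basis. chi_deriv x i \<bullet> i) = DIM('b) + 1"
proof -
  have n0: "norm (fst x) > 0" using assms closure_subset norm_fst_pos by blast
  have "(\<Sum>i\<in>Basis. chi_deriv x i \<bullet> i) =
      (\<Sum>i\<in>(Basis::('a \<times> 'b) set). ((((1 - theta x) / DIM('a)) *\<^sub>R fst i +
     (theta x / (norm (fst x))\<^sup>2 * (fst x \<bullet> fst i)) *\<^sub>R fst x, 0) :: 'a \<times> 'b) \<bullet> i)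
      + (\<Sum>i\<in>(Basis::('a \<times> 'b) set). snd i \<bullet> snd i)"
    unfolding chi_deriv_def by (simp add: sum.distrib[symmetric] inner_prod_def)
  also have "\<dots> = 1 - theta x + theta x + DIM('b)"
    unfolding sum_Basis_fst_inner using n0 by (simp add: sum_Basis_prod dot_square_norm)
  finally show ?thesis by simp
qed

lemma continuous_theta: "continuous_on (closure \<Omega>) theta"
  unfolding theta_def[abs_def] using norm_fst_pos by (intro continuous_intros) auto

lemma continuous_chi: "continuous_on (closure \<Omega>) chi"
  unfolding chi_def[abs_def] by (intro continuous_intros continuous_theta) auto

lemma continuous_chi_deriv:
  "continuous_on (closure \<Omega>) f \<Longrightarrow> continuous_on (closure \<Omega>) (\<lambda>x. chi_deriv x (f x))"
  unfolding chi_deriv_def[abs_def] using norm_fst_pos by (intro continuous_intros continuous_theta) auto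

lemma continuous_pohozaev: "continuous_on (closure \<Omega>) pohozaev"
  unfolding pohozaev_def[abs_def] using p_gt_2
  by (intro continuous_intros continuous_chi contu contG continuous_on_powr') auto

lemma continuous_pohozaev_div: "continuous_on (closure \<Omega>) pohozaev_div"
  unfolding pohozaev_div_def[abs_def] by (intro continuous_intros continuous_chi_deriv contG)

lemma continuous_pohozaev_deriv: "continuous_on \<Omega> (\<lambda>x. pohozaev_deriv x v)"
proof -
  note c = continuous_on_subset[OF _ closure_subset]
  have "continuous_on \<Omega> (\<lambda>x. chi_deriv x v)"
    by (rule c[OF continuous_chi_deriv[OF continuous_on_const]])
  moreover have "continuous_on \<Omega> u" "continuous_on \<Omega> G" "continuous_on \<Omega> chi"
    by (rule c, rule contu contG continuous_chi)+
  ultimately show ?thesis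
    unfolding pohozaev_deriv_def using p_gt_2 by (intro continuous_intros contH continuous_on_powr') auto
qed

section \<open>Divergence and boundary flux of the Pohozaev field\<close>

lemma pohozaev_has_derivative:
  assumes x: "x \<in> \<Omega>"
  shows "(pohozaev has_derivative pohozaev_deriv x) (at x)"
proof -
  have dp: "((\<lambda>x. \<bar>u x\<bar> powr p / p) has_derivative (\<lambda>v. \<bar>u x\<bar> powr (p - 2) * u x * (G x \<bullet> v))) (at x)"
    using has_derivative_compose[OF du[OF x] has_real_derivative_abs_powr[OF p_gt_2, unfolded has_field_derivative_def]] p_gt_2
    by (auto simp: divide_inverse intro!: has_derivative_eq_rhs[OF has_derivative_mult_left])
  note d = dG[OF x] chi_has_derivative[OF x]
  have d1: "((\<lambda>x. chi x \<bullet> G x) has_derivative (\<lambda>v. chi x \<bullet> H x v + chi_deriv x v \<bullet> G x)) (at x)"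
    by (rule has_derivative_inner[OF d(2,1)])
  have "((\<lambda>x. (G x \<bullet> G x) / 2) has_derivative (\<lambda>v. G x \<bullet> H x v)) (at x)"
    using has_derivative_mult_right[OF has_derivative_inner[OF d(1) d(1)], of "1 / 2"] by (simp add: inner_commute)
  note d2 = has_derivative_diff[OF dp this]
  show ?thesis
    unfolding pohozaev_def[abs_def] pohozaev_deriv_def
    by (rule has_derivative_add[OF has_derivative_add[OF has_derivative_scaleR[OF d1 d(1)] has_derivative_scaleR[OF d2 d(2)]]
          has_derivative_scaleR[OF has_derivative_mult_right[OF du[OF x]] d(1)]])
qed

text \<open>Three cancellations: the Hessian terms by symmetry, the nonlinearity paired with
  \<open>chi x \<bullet> G x\<close> by the equation, and the multiples of
  \<open>\<bar>u x\<bar> powr p\<close> by the choice of \<open>kappa\<close>.\<close>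

lemma pohozaev_divergence:
  assumes x: "x \<in> \<Omega>"
  shows "(\<Sum>i\<in>Basis. pohozaev_deriv x i \<bullet> i) = pohozaev_div x"
proof -
  let ?N = "\<bar>u x\<bar> powr (p - 2) * u x" and ?P = "\<bar>u x\<bar> powr p / p - (G x \<bullet> G x) / 2"
  have linH: "linear (H x)" using dG[OF x] has_derivative_linear by blast
  have sym: "H x v \<bullet> w = H x w \<bullet> v" for v w
    by (rule hessian_symmetric[OF open_Omega x du dG contH])
  have linc: "linear (\<lambda>v. c \<bullet> H x v)" for c
    using linear_compose[OF linH bounded_linear.linear[OF bounded_linear_inner_right]] by (simp add: o_def)
  have lind: "linear (\<lambda>v. chi_deriv x v \<bullet> c)" for c
    using linear_compose[OF chi_deriv_linear bounded_linear.linear[OF bounded_linear_inner_left]] by (simp add: o_def)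
  have s1: "(\<Sum>i\<in>Basis. (chi x \<bullet> H x i) * (G x \<bullet> i)) = chi x \<bullet> H x (G x)"
    by (rule sum_Basis_inner_mult) (rule linc)
  have s2: "(\<Sum>i\<in>Basis. (chi_deriv x i \<bullet> G x) * (G x \<bullet> i)) = chi_deriv x (G x) \<bullet> G x"
    by (rule sum_Basis_inner_mult) (rule lind)
  have s3: "(\<Sum>i\<in>Basis. (G x \<bullet> H x i) * (chi x \<bullet> i)) = G x \<bullet> H x (chi x)"
    by (rule sum_Basis_inner_mult) (rule linc)
  have s4: "(\<Sum>i\<in>Basis. (G x \<bullet> i) * (chi x \<bullet> i)) = G x \<bullet> chi x"
    "(\<Sum>i\<in>Basis. (G x \<bullet> i) * (G x \<bullet> i)) = G x \<bullet> G x" by (simp_all add: euclidean_inner[symmetric])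
  have eq13: "chi x \<bullet> H x (G x) = G x \<bullet> H x (chi x)" using sym[of "G x" "chi x"] by (simp add: inner_commute)
  have uN: "u x * ?N = \<bar>u x\<bar> powr p"
  proof -
    have "u x * ?N = \<bar>u x\<bar> * (\<bar>u x\<bar> * \<bar>u x\<bar> powr (p - 2))" by (simp add: algebra_simps)
    also have "\<dots> = \<bar>u x\<bar> powr p" by (simp add: powr_mult_base)
    finally show ?thesis .
  qed
  have "(\<Sum>i\<in>Basis. pohozaev_deriv x i \<bullet> i) = (\<Sum>i\<in>Basis. (chi x \<bullet> G x) * (H x i \<bullet> i)
      + (chi x \<bullet> H x i) * (G x \<bullet> i) + (chi_deriv x i \<bullet> G x) * (G x \<bullet> i) + ?P * (chi_deriv x i \<bullet> i)
      + ?N * ((G x \<bullet> i) * (chi x \<bullet> i)) - (G x \<bullet> H x i) * (chi x \<bullet> i)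
      + kappa * u x * (H x i \<bullet> i) + kappa * ((G x \<bullet> i) * (G x \<bullet> i)))"
    by (intro sum.cong refl) (simp only: pohozaev_deriv_def inner_add_left inner_scaleR_left, simp add: algebra_simps)
  also have "\<dots> = (chi x \<bullet> G x) * - ?N + chi x \<bullet> H x (G x) + chi_deriv x (G x) \<bullet> G x + ?P * (DIM('b) + 1)
      + ?N * (G x \<bullet> chi x) - G x \<bullet> H x (chi x) + kappa * u x * - ?N + kappa * (G x \<bullet> G x)"
    by (simp only: sum.distrib sum_subtractf sum_distrib_left[symmetric] s1 s2 s3 s4 chi_div[OF x] eqn[OF x])
  also have "\<dots> = chi_deriv x (G x) \<bullet> G x + ?P * (DIM('b) + 1) - kappa * \<bar>u x\<bar> powr p + kappa * (G x \<bullet> G x)"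
    using eq13 uN by (simp add: inner_commute algebra_simps)
  also have "\<dots> = pohozaev_div x"
    unfolding pohozaev_div_def kappa_def using p_gt_2 by (simp add: field_simps)
  finally show ?thesis .
qed

text \<open>Cauchy-Schwarz replaces the quadratic form of \<open>chi_deriv\<close> in the
  y-directions by its largest eigenvalue \<open>(1 - theta x) / d + theta x\<close>, with d =
  \<open>DIM('a)\<close>. Subtracting 1 gives \<open>- (1 - theta x) * (1 - 1 / d)\<close>, and the
  z-directions contribute nothing positive.\<close>

lemma pohozaev_div_le:
  assumes x: "x \<in> closure \<Omega>"
  shows "pohozaev_div x \<le> - ((1 - theta x) * (1 - 1 / DIM('a)) * (norm (fst (G x)))\<^sup>2)"
proof -
  let ?g = "fst (G x)" and ?h = "snd (G x)" and ?y = "fst x"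
  have n0: "norm ?y > 0" using norm_fst_pos[OF x] .
  have GG: "G x \<bullet> G x = (norm ?g)\<^sup>2 + (norm ?h)\<^sup>2" by (simp add: inner_prod_def dot_square_norm)
  have "(?y \<bullet> ?g)\<^sup>2 \<le> (norm ?y)\<^sup>2 * (norm ?g)\<^sup>2"
    using Cauchy_Schwarz_ineq[of ?y ?g] by (simp add: dot_square_norm)
  then have "theta x / (norm ?y)\<^sup>2 * (?y \<bullet> ?g)\<^sup>2 \<le> theta x / (norm ?y)\<^sup>2 * ((norm ?y)\<^sup>2 * (norm ?g)\<^sup>2)"
    using theta_bounds[OF x] by (intro mult_left_mono) auto
  also have "\<dots> = theta x * (norm ?g)\<^sup>2" using n0 by simp
  finally have "theta x / (norm ?y)\<^sup>2 * (?y \<bullet> ?g)\<^sup>2 \<le> theta x * (norm ?g)\<^sup>2" .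
  moreover have "chi_deriv x (G x) \<bullet> G x = (1 - theta x) / DIM('a) * (norm ?g)\<^sup>2 + theta x / (norm ?y)\<^sup>2 * (?y \<bullet> ?g)\<^sup>2 + (norm ?h)\<^sup>2"
    by (simp add: chi_deriv_def inner_prod_def inner_add_left power2_norm_eq_inner power2_eq_square[of "?y \<bullet> ?g"])
  moreover have "(kappa - real (DIM('b) + 1) / 2) * (G x \<bullet> G x) \<le> -1 * (G x \<bullet> G x)"
    using kappa_le by (intro mult_right_mono) auto
  ultimately show ?thesis unfolding pohozaev_div_def GG by (simp add: algebra_simps)
qed

lemma pohozaev_div_nonpos: "x \<in> closure \<Omega> \<Longrightarrow> pohozaev_div x \<le> 0"
proof -
  assume x: "x \<in> closure \<Omega>"
  have "1 - 1 / real (DIM('a)) \<ge> 0" using dims by simp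
  then have "0 \<le> (1 - theta x) * (1 - 1 / DIM('a)) * (norm (fst (G x)))\<^sup>2"
    using theta_bounds[OF x] by (intro mult_nonneg_nonneg) auto
  then show ?thesis using pohozaev_div_le[OF x] by linarith
qed

text \<open>Here \<open>u\<close> is 0 and \<open>G x\<close> is \<open>l\<close> times y, so the
  quadratic gradient term removes half of the leading one. The factor \<open>1 - theta x\<close>
  gives the required sign on both spheres: it is 0 for |y| = a, whatever \<open>l\<close> is, and
  nonnegative for |y| = b.\<close>

lemma pohozaev_boundary:
  assumes x: "norm (fst x) = r" "r = a \<or> r = b"
  shows "\<exists>l. fst x \<bullet> fst (pohozaev x) = (1 - theta x) / DIM('a) * (l\<^sup>2 * r ^ 4 / 2)"
proof -
  obtain l where l: "G x = (l *\<^sub>R fst x, 0)"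
    using boundary_gradient[OF contu u0 contG du dims(1) x] by blast
  have "u x = 0" using u0 boundary_mem_closure(3)[OF x] by blast
  moreover have yy: "fst x \<bullet> fst x = r\<^sup>2" using x by (simp add: dot_square_norm)
  define c where "c = (1 - theta x) / DIM('a)"
  have "chi x \<bullet> G x = c * l * r\<^sup>2" "G x \<bullet> G x = l\<^sup>2 * r\<^sup>2"
    by (simp_all add: chi_def l c_def yy power2_eq_square)
  ultimately have "fst (pohozaev x) = (c * l * r\<^sup>2 * l - l\<^sup>2 * r\<^sup>2 / 2 * c) *\<^sub>R fst x"
    by (simp add: pohozaev_def l chi_def c_def[symmetric] scaleR_diff_left)
  then have "fst x \<bullet> fst (pohozaev x) = (c * l * r\<^sup>2 * l - l\<^sup>2 * r\<^sup>2 / 2 * c) * r\<^sup>2"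
    using yy by simp
  also have "\<dots> = (1 - theta x) / DIM('a) * (l\<^sup>2 * r ^ 4 / 2)"
    unfolding c_def[symmetric] by (simp add: power2_eq_square power4_eq_xxxx algebra_simps)
  finally have "fst x \<bullet> fst (pohozaev x) = (1 - theta x) / DIM('a) * (l\<^sup>2 * r ^ 4 / 2)" .
  then show ?thesis ..
qed

lemma pohozaev_flux: "R > 0 \<Longrightarrow> 0 \<le> integral \<Omega> (\<lambda>x. bump R (snd x) * pohozaev_div x + bump_deriv R (snd x) (snd (pohozaev x)))"
proof (rule flux_nonneg[where F'=pohozaev_deriv])
  show "fst x \<bullet> fst (pohozaev x) \<ge> 0" if x: "x \<in> closure \<Omega>" "norm (fst x) = b" for x
  proof -
    obtain l where "fst x \<bullet> fst (pohozaev x) = (1 - theta x) / DIM('a) * (l\<^sup>2 * b ^ 4 / 2)"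
      using pohozaev_boundary[OF x(2)] by blast
    moreover have "\<dots> \<ge> 0" using theta_bounds[OF x(1)] ab by (intro mult_nonneg_nonneg) auto
    ultimately show ?thesis by simp
  qed
  show "fst x \<bullet> fst (pohozaev x) \<le> 0" if "x \<in> closure \<Omega>" "norm (fst x) = a" for x
    using pohozaev_boundary[OF that(2)] that(2) ab by (auto simp: theta_def)
  show "continuous_on \<Omega> (\<lambda>x. pohozaev_deriv x i \<bullet> i)" for i by (intro continuous_intros continuous_pohozaev_deriv)
qed (use continuous_pohozaev continuous_pohozaev_div pohozaev_has_derivative pohozaev_divergence in auto)

text \<open>The dominating function for the error terms caused by the cutoff at infinity.\<close>

definition pohozaev_bound :: "'a \<times> 'b \<Rightarrow> real" where
  "pohozaev_bound x = (b + 2 + kappa) * (norm (G x))\<^sup>2 + \<bar>u x\<bar> powr p + kappa * (u x)\<^sup>2"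

lemma pohozaev_bound_integrable: "pohozaev_bound integrable_on \<Omega>"
  unfolding pohozaev_bound_def[abs_def]
  by (intro integrable_add integrable_on_mult_right intG intu square_integrable[OF contu u0 contG du dims(1) intG])

text \<open>The bound is independent of \<open>R\<close>. On |z| \<le> R the field grows at most
  linearly in \<open>R\<close>, because \<chi> contains z itself; the cutoff gradient contributes
  another |z| over \<open>R\<^sup>2\<close>, which absorbs both powers. Assuming R \<ge> 1 lets
  bounded terms be estimated by multiples of \<open>R\<close>.\<close>

lemma bump_deriv_pohozaev_le:
  assumes x: "x \<in> \<Omega>" and R: "R \<ge> 1"
  shows "\<bar>bump_deriv R (snd x) (snd (pohozaev x))\<bar> \<le> 4 * pohozaev_bound x"
proof (cases "norm (snd x) \<le> R")
  case False
  have "0 \<le> pohozaev_bound x" unfolding pohozaev_bound_def using kappa_nonneg ab by (intro add_nonneg_nonneg mult_nonneg_nonneg) auto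
  then show ?thesis using bump_outside(2)[of R "snd x"] False R by simp
next
  case True
  have xc: "x \<in> closure \<Omega>" using x closure_subset by blast
  let ?n = "norm (G x)" and ?z = "snd x"
  have chi: "norm (chi x) \<le> (b + 1) * R"
  proof -
    define c where "c = (1 - theta x) / DIM('a)"
    have "c \<le> 1" "0 \<le> c"
      using theta_bounds[OF xc] dims by (auto simp: c_def divide_le_eq)
    moreover have "norm (fst x) \<le> b" using x by (simp add: in_Omega)
    ultimately have "\<bar>c\<bar> * norm (fst x) \<le> 1 * b"
      by (intro mult_mono) auto
    then have "norm (((1 - theta x) / DIM('a)) *\<^sub>R fst x) \<le> b"
      unfolding norm_scaleR c_def by simp
    then have "norm (chi x) \<le> b + norm ?z"
      unfolding chi_def using norm_Pair_le[of "((1 - theta x) / DIM('a)) *\<^sub>R fst x" ?z] by linarith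
    also have "\<dots> \<le> b * R + R" using True R ab by (intro add_mono) auto
    finally show ?thesis by (simp add: algebra_simps)
  qed
  have "norm (snd (pohozaev x)) \<le> norm ((chi x \<bullet> G x) *\<^sub>R snd (G x)) + norm ((\<bar>u x\<bar> powr p / p - (G x \<bullet> G x) / 2) *\<^sub>R ?z)
      + norm ((kappa * u x) *\<^sub>R snd (G x))"
    unfolding pohozaev_def chi_def by (simp add: norm_triangle_le)
  also have "norm ((chi x \<bullet> G x) *\<^sub>R snd (G x)) \<le> ((b + 1) * R * ?n) * ?n"
    unfolding norm_scaleR real_norm_def
    by (intro mult_mono order_trans[OF Cauchy_Schwarz_ineq2] chi norm_snd_le_norm) (use ab R in auto)
  also have "norm ((\<bar>u x\<bar> powr p / p - (G x \<bullet> G x) / 2) *\<^sub>R ?z) \<le> (\<bar>u x\<bar> powr p + ?n\<^sup>2) * R"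
  proof -
    have "0 \<le> \<bar>u x\<bar> powr p / p" "\<bar>u x\<bar> powr p / p \<le> \<bar>u x\<bar> powr p"
      using p_gt_2 by (auto simp: divide_le_eq mult_le_cancel_left1)
    then have "\<bar>\<bar>u x\<bar> powr p / p - (G x \<bullet> G x) / 2\<bar> \<le> \<bar>u x\<bar> powr p + ?n\<^sup>2"
      unfolding dot_square_norm using zero_le_power2[of ?n] by linarith
    then show ?thesis unfolding norm_scaleR real_norm_def using True by (intro mult_mono) auto
  qed
  also have "norm ((kappa * u x) *\<^sub>R snd (G x)) \<le> kappa * ((u x)\<^sup>2 + ?n\<^sup>2) * R"
  proof -
    have "norm ((kappa * u x) *\<^sub>R snd (G x)) \<le> kappa * (\<bar>u x\<bar> * ?n)"
      using kappa_nonneg norm_snd_le_norm[of "G x"] by (simp add: abs_mult mult_left_mono mult.assoc)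
    also have "\<bar>u x\<bar> * ?n \<le> (u x)\<^sup>2 + ?n\<^sup>2"
    proof -
      have "2 * (\<bar>u x\<bar> * ?n) \<le> (u x)\<^sup>2 + ?n\<^sup>2" using sum_squares_bound[of "\<bar>u x\<bar>" ?n] by (simp add: mult.assoc)
      moreover have "0 \<le> \<bar>u x\<bar> * ?n" by simp
      ultimately show ?thesis by linarith
    qed
    also have "kappa * ((u x)\<^sup>2 + ?n\<^sup>2) \<le> kappa * ((u x)\<^sup>2 + ?n\<^sup>2) * R"
      using kappa_nonneg R mult_left_mono[OF R, of "kappa * ((u x)\<^sup>2 + ?n\<^sup>2)"] by simp
    finally show ?thesis using kappa_nonneg by (simp add: mult_left_mono)
  qed
  \<comment> \<open>The three summands contribute \<open>b + 1\<close>, 1 and \<open>kappa\<close>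
    to the coefficient of the squared gradient, hence the \<open>b + 2 + kappa\<close> in
    \<open>pohozaev_bound\<close>.\<close>
  finally have snd_le: "norm (snd (pohozaev x)) \<le> R * pohozaev_bound x"
    by (simp add: pohozaev_bound_def algebra_simps power2_eq_square)
  have m: "0 \<le> max 0 (1 - (?z \<bullet> ?z) / R\<^sup>2)" "max 0 (1 - (?z \<bullet> ?z) / R\<^sup>2) \<le> 1" by auto
  have "\<bar>bump_deriv R ?z (snd (pohozaev x))\<bar> = 4 * max 0 (1 - (?z \<bullet> ?z) / R\<^sup>2) / R\<^sup>2 * \<bar>?z \<bullet> snd (pohozaev x)\<bar>"
    using m(1) by (simp add: bump_deriv_def abs_mult)
  also have "\<dots> \<le> 4 * 1 / R\<^sup>2 * (R * (R * pohozaev_bound x))"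
    using m R True snd_le by (intro mult_mono divide_right_mono order_trans[OF Cauchy_Schwarz_ineq2]) auto
  also have "\<dots> = 4 * pohozaev_bound x" using R by (simp add: power2_eq_square)
  finally show ?thesis .
qed

section \<open>Vanishing of the divergence and of the solution\<close>

text \<open>The weighted integrals of \<open>- pohozaev_div\<close> are nonnegative, increase with
  the radius, and are bounded by error terms that tend to 0. Hence each of them vanishes, and
  continuity turns this into a pointwise statement.\<close>

lemma pohozaev_div_eq_0:
  assumes x: "x \<in> \<Omega>"
  shows "pohozaev_div x = 0"
proof -
  define T where "T n x = bump_deriv (real (Suc n)) (snd x) (snd (pohozaev x))" for n x
  have cT: "continuous_on (closure \<Omega>) (T n)" for n
    unfolding T_def by (intro continuous_intros continuous_pohozaev)
  have iT: "T n integrable_on \<Omega>" for n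
    by (rule integrable_on_Omega[OF cT, of "Suc n"]) (simp add: T_def bump_outside)
  define Q where "Q n x = bump (real (Suc n)) (snd x) * - pohozaev_div x" for n x
  have cQ: "continuous_on (closure \<Omega>) (Q n)" for n
    unfolding Q_def by (intro continuous_intros continuous_pohozaev_div)
  have iQ: "Q n integrable_on \<Omega>" for n
    by (rule integrable_on_Omega[OF cQ, of "Suc n"]) (simp add: Q_def bump_outside)
  have Q0: "0 \<le> Q n x" if "x \<in> \<Omega>" for n x
    using pohozaev_div_nonpos[of x] that closure_subset bump_bounds(1) unfolding Q_def by (intro mult_nonneg_nonneg) auto
  have QT: "integral \<Omega> (Q n) \<le> integral \<Omega> (T n)" for n
  proof -
    have "0 \<le> integral \<Omega> (\<lambda>x. T n x - Q n x)"
      using pohozaev_flux[of "Suc n"] by (simp add: T_def Q_def algebra_simps)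
    also have "\<dots> = integral \<Omega> (T n) - integral \<Omega> (Q n)"
      by (intro integral_unique has_integral_diff integrable_integral iT iQ)
    finally show ?thesis by simp
  qed
  have "(\<lambda>n. integral \<Omega> (T n)) \<longlonglongrightarrow> integral \<Omega> (\<lambda>x. 0)"
  proof (rule dominated_convergence(2))
    show "(\<lambda>x. 4 * pohozaev_bound x) integrable_on \<Omega>" by (intro integrable_on_mult_right pohozaev_bound_integrable)
    show "norm (T n x) \<le> 4 * pohozaev_bound x" if "x \<in> \<Omega>" for n x
      unfolding T_def real_norm_def by (rule bump_deriv_pohozaev_le[OF that]) simp
    show "(\<lambda>n. T n x) \<longlonglongrightarrow> 0" for x
    proof -
      have "(\<lambda>n. inverse (real (Suc n))) \<longlonglongrightarrow> 0" by (rule LIMSEQ_inverse_real_of_nat)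
      then have "(\<lambda>n. - (4 * max 0 (1 - (snd x \<bullet> snd x) * (inverse (real (Suc n)))\<^sup>2) * (inverse (real (Suc n)))\<^sup>2) * (snd x \<bullet> snd (pohozaev x)))
          \<longlonglongrightarrow> - (4 * max 0 (1 - (snd x \<bullet> snd x) * 0\<^sup>2) * 0\<^sup>2) * (snd x \<bullet> snd (pohozaev x))"
        by (intro tendsto_intros)
      then show ?thesis by (simp add: T_def bump_deriv_def divide_inverse power_inverse)
    qed
  qed (rule iT)
  then have T0: "(\<lambda>n. integral \<Omega> (T n)) \<longlonglongrightarrow> 0" by simp
  \<comment> \<open>Only one weight is kept: \<open>Q k\<close> uses radius k + 1, which exceeds
    |z|, so the weight is positive at \<open>x\<close> and can be divided out at the end.\<close>
  obtain k :: nat where k: "norm (snd x) < k" using reals_Archimedean2 by blast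
  have "integral \<Omega> (Q k) \<le> integral \<Omega> (T n)" if "n \<ge> k" for n
  proof -
    have "integral \<Omega> (Q k) \<le> integral \<Omega> (Q n)"
    proof (rule integral_le[OF iQ iQ])
      show "Q k x \<le> Q n x" if "x \<in> \<Omega>" for x
        unfolding Q_def using pohozaev_div_nonpos[of x] that closure_subset \<open>n \<ge> k\<close>
        by (intro mult_right_mono bump_mono) auto
    qed
    then show ?thesis using QT[of n] by linarith
  qed
  then have le0: "integral \<Omega> (Q k) \<le> 0"
    by (intro tendsto_lowerbound[OF T0]) (auto simp: eventually_sequentially)
  \<comment> \<open>On a box around \<open>x\<close> inside \<Omega>, \<open>Q k\<close> is
    continuous and nonnegative with integral 0, hence zero at \<open>x\<close>.\<close>
  obtain c d where cd: "x \<in> box c d" "cbox c d \<subseteq> \<Omega>"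
    using open_contains_cbox[OF open_Omega x] by metis
  have cQ': "continuous_on (cbox c d) (Q k)"
    by (rule continuous_on_subset[OF cQ order_trans[OF cd(2) closure_subset]])
  have "integral (cbox c d) (Q k) \<le> integral \<Omega> (Q k)"
    by (rule integral_subset_le[OF cd(2) integrable_continuous[OF cQ'] iQ]) (use Q0 in blast)
  moreover have "0 \<le> integral (cbox c d) (Q k)"
    by (rule integral_nonneg[OF integrable_continuous[OF cQ']]) (use Q0 cd in auto)
  ultimately have "integral (cbox c d) (Q k) = 0" using le0 by linarith
  then have "(Q k has_integral 0) (cbox c d)" using integrable_integral[OF integrable_continuous[OF cQ']] by simp
  then have "Q k x = 0"
    using has_integral_0_cbox_imp_0[OF cQ', of x] Q0 cd box_subset_cbox[of c d] by blast
  moreover have "bump (real (Suc k)) (snd x) > 0"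
  proof -
    have "(norm (snd x))\<^sup>2 < (real (Suc k))\<^sup>2" using k by (intro power_strict_mono) auto
    then have "(snd x \<bullet> snd x) / (real (Suc k))\<^sup>2 < 1" by (simp add: dot_square_norm del: of_nat_Suc)
    then show ?thesis unfolding bump_def by (simp add: max_def)
  qed
  ultimately show ?thesis by (simp add: Q_def)
qed

lemma fst_gradient_eq_0:
  assumes x: "x \<in> \<Omega>"
  shows "fst (G x) = 0"
proof (rule ccontr)
  assume "fst (G x) \<noteq> 0"
  moreover have "1 - 1 / real (DIM('a)) > 0" using dims by simp
  ultimately have "0 < (1 - theta x) * (1 - 1 / DIM('a)) * (norm (fst (G x)))\<^sup>2"
    using theta_less_1[OF x] by (intro mult_pos_pos) auto
  then show False using pohozaev_div_le[of x] pohozaev_div_eq_0[OF x] x closure_subset by force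
qed

text \<open>With z fixed, \<open>u\<close> is constant along the ray through y, because its
  derivative there involves only the y-gradient; the ray meets the outer sphere |y| = b at parameter
  \<open>B\<close>.\<close>

lemma solution_eq_0:
  assumes x: "x \<in> \<Omega>"
  shows "u x = 0"
proof -
  let ?q = "\<lambda>t. (t *\<^sub>R fst x, snd x)"
  define B where "B = b / norm (fst x)"
  have n: "a < norm (fst x)" "norm (fst x) < b" "0 < norm (fst x)" using x ab by (auto simp: in_Omega)
  have B: "1 < B" using n by (simp add: B_def)
  have bd: "norm (fst (?q B)) = b" using n ab by (simp add: B_def)
  have qO: "?q t \<in> \<Omega>" if "1 \<le> t" "t < B" for t
  proof -
    have "norm (fst x) \<le> t * norm (fst x)" using that n by simp
    moreover have "t * norm (fst x) < b" using that n by (simp add: B_def pos_less_divide_eq)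
    moreover have "norm (t *\<^sub>R fst x) = t * norm (fst x)" using that by simp
    ultimately show ?thesis unfolding in_Omega fst_conv using n(1) by linarith
  qed
  have qc: "?q t \<in> closure \<Omega>" if "1 \<le> t" "t \<le> B" for t
    using qO[of t] that boundary_mem_closure(1)[OF bd] closure_subset by (cases "t = B") auto
  have "u (?q B) = u (?q 1)"
  proof (rule DERIV_isconst_end[OF B])
    show "continuous_on {1..B} (\<lambda>t. u (?q t))"
      by (rule continuous_on_compose2[OF contu]) (use qc in \<open>auto intro!: continuous_intros\<close>)
    show "((\<lambda>t. u (?q t)) has_real_derivative 0) (at t)" if "1 < t" "t < B" for t
    proof -
      have t: "?q t \<in> \<Omega>" using qO that by simp
      have "(?q has_derivative (\<lambda>h. (h *\<^sub>R fst x, 0))) (at t)" by (auto intro!: derivative_eq_intros)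
      from has_derivative_compose[OF this du[OF t]]
      have "((\<lambda>t. u (?q t)) has_derivative (\<lambda>h. 0)) (at t)"
        by (simp add: inner_prod_def fst_gradient_eq_0[OF t])
      then show ?thesis by (simp add: has_field_derivative_def lambda_zero)
    qed
  qed
  moreover have "u (?q B) = 0" using u0 boundary_mem_closure(3)[OF bd] by blast
  ultimately show ?thesis by simp
qed

end

section \<open>From partial derivatives to the coordinate-free setting\<close>

lemma frechet_derivative_eq_pderiv_dir:
  assumes "f differentiable (at x)"
  shows "frechet_derivative f (at x) v = (\<Sum>i\<in>Basis. pderiv_dir f i x * (v \<bullet> i))"
  using sum_Basis_inner_mult[of "frechet_derivative f (at x)" v] linear_frechet_derivative[OF assms]
  by (simp add: pderiv_dir_def)

text \<open>The dictionary is m + 1 = \<open>DIM('a)\<close> and N - m - 1 = \<open>DIM('b)\<close>.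
  Thus m \<ge> 1 and m < N - 2 become the two dimension bounds, and N - m in the exponent becomes
  \<open>DIM('b) + 1\<close>.\<close>

theorem theorem1p1:
  fixes a b p :: real
    and u :: "('a::euclidean_space \<times> 'b::euclidean_space) \<Rightarrow> real"
    and \<Omega> :: "('a \<times> 'b) set"
  assumes m_ge: "DIM('a) \<ge> 2"
    and m_lt: "DIM('b) \<ge> 2"
    and ab: "0 < a" "a < b"
    and Omega_def: "\<Omega> = {(y, z). a < norm y \<and> norm y < b}"
    and p_ge: "p \<ge> 2 * real (DIM('b) + 1) / (real (DIM('b) + 1) - 2)"
  shows "\<not> (C2_on \<Omega> u \<and> C1_closure \<Omega> u
            \<and> (\<forall>x\<in>\<Omega>. - laplacian u x = \<bar>u x\<bar> powr (p - 2) * u x)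
            \<and> (\<forall>x\<in>frontier \<Omega>. u x = 0)
            \<and> (\<lambda>x. (norm (grad u x))\<^sup>2) integrable_on \<Omega>
            \<and> (\<lambda>x. \<bar>u x\<bar> powr p) integrable_on \<Omega>
            \<and> (\<exists>x\<in>\<Omega>. u x \<noteq> 0))"
proof (rule notI, elim conjE)
  assume C2: "C2_on \<Omega> u" and C1: "C1_closure \<Omega> u"
    and eqn: "\<forall>x\<in>\<Omega>. - laplacian u x = \<bar>u x\<bar> powr (p - 2) * u x"
    and u0: "\<forall>x\<in>frontier \<Omega>. u x = 0"
    and intG: "(\<lambda>x. (norm (grad u x))\<^sup>2) integrable_on \<Omega>"
    and intu: "(\<lambda>x. \<bar>u x\<bar> powr p) integrable_on \<Omega>"
    and ne: "\<exists>x\<in>\<Omega>. u x \<noteq> 0"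
  interpret annular_cylinder a b \<Omega> using ab Omega_def by unfold_locales
  have diff: "f differentiable (at x)" if "C1_on \<Omega> f" "x \<in> \<Omega>" for f x
    using that open_Omega by (auto simp: C1_on_def differentiable_on_eq_differentiable_at)
  from C1 obtain g where g: "\<And>i. i \<in> Basis \<Longrightarrow> continuous_on (closure \<Omega>) (g i)"
    "\<And>i x. i \<in> Basis \<Longrightarrow> x \<in> \<Omega> \<Longrightarrow> g i x = pderiv_dir u i x"
    unfolding C1_closure_def by metis
  \<comment> \<open>Built from the extensions \<open>g\<close> and not from \<open>grad u\<close>:
    at the boundary \<open>frechet_derivative\<close> may be an arbitrary default, so
    \<open>grad u\<close> says nothing there.\<close>
  define G where "G x = (\<Sum>i\<in>Basis. g i x *\<^sub>R i)" for x
  define H where "H x v = (\<Sum>i\<in>Basis. frechet_derivative (pderiv_dir u i) (at x) v *\<^sub>R i)" for x v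
  have G_grad: "G x = grad u x" if "x \<in> \<Omega>" for x
    using that by (simp add: G_def grad_def g)
  have C1u: "C1_on \<Omega> u" and C1p: "\<And>i. i \<in> Basis \<Longrightarrow> C1_on \<Omega> (pderiv_dir u i)"
    using C2 by (auto simp: C2_on_def)
  interpret supercritical_solution a b \<Omega> u G H p
  proof
    show "continuous_on (closure \<Omega>) u" using C1 by (simp add: C1_closure_def)
    show "continuous_on (closure \<Omega>) G" unfolding G_def by (intro continuous_intros g(1))
    show "(u has_derivative (\<lambda>v. G x \<bullet> v)) (at x)" if x: "x \<in> \<Omega>" for x
    proof -
      have d: "u differentiable (at x)" using diff[OF C1u x] .
      have "frechet_derivative u (at x) v = G x \<bullet> v" for v
        using x by (simp add: frechet_derivative_eq_pderiv_dir[OF d] G_def g inner_sum_left inner_sum_right inner_commute)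
      then show ?thesis using d unfolding frechet_derivative_works by presburger
    qed
    show "(G has_derivative H x) (at x)" if x: "x \<in> \<Omega>" for x
    proof -
      have "((\<lambda>x. \<Sum>i\<in>Basis. pderiv_dir u i x *\<^sub>R i) has_derivative H x) (at x)"
        unfolding H_def
        by (intro has_derivative_sum has_derivative_scaleR_left frechet_derivative_works[THEN iffD1] diff[OF C1p x])
      then show ?thesis
        by (rule has_derivative_transform_within_open[OF _ open_Omega x]) (simp add: G_def g)
    qed
    show "continuous_on \<Omega> (\<lambda>x. H x v)" for v
    proof -
      have "continuous_on \<Omega> (\<lambda>x. \<Sum>i\<in>Basis. (\<Sum>j\<in>Basis. pderiv_dir (pderiv_dir u i) j x * (v \<bullet> j)) *\<^sub>R i)"
        using C1p by (intro continuous_intros) (auto simp: C1_on_def)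
      then show ?thesis
        by (rule continuous_on_eq) (simp add: H_def frechet_derivative_eq_pderiv_dir diff C1p)
    qed
    show "(\<Sum>i\<in>Basis. H x i \<bullet> i) = - (\<bar>u x\<bar> powr (p - 2) * u x)" if x: "x \<in> \<Omega>" for x
    proof -
      have "(\<Sum>i\<in>Basis. H x i \<bullet> i) = laplacian u x"
        unfolding laplacian_def H_def
        by (intro sum.cong refl) (simp add: pderiv_dir_def inner_sum_left_Basis)
      then show ?thesis using eqn x by fastforce
    qed
    show "(\<lambda>x. (norm (G x))\<^sup>2) integrable_on \<Omega>"
      by (rule integrable_eq[OF intG]) (simp add: G_grad)
  qed (use m_ge m_lt p_ge u0 intu in auto)
  show False using ne solution_eq_0 by blast
qed

end
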